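(* Let $r\geq 1$ and let $a_1,\dots,a_r$ be positive integers, and let $G=(\mathbb Z/a_1\mathbb Z)\times\dots\times(\mathbb Z/a_r\mathbb Z)$ (an $r$-dimensional grid with periodic addition). Let $f:G\to\mathbb Q$ be a rational-valued function. (i) If $|G|$ is odd, then $f$ is determined up to translation by its autocorrelations up to order $2r+2$: for every rational-valued $g:G\to\mathbb Q$ with $M_n(g;x_1,\dots,x_{n-1})=M_n(f;x_1,\dots,x_{n-1})$ for all $1\le n\le 2r+2$ and all $x_1,\dots,x_{n-1}\in G$, there exists $y\in G$ with $g(x)=f(x+y)$ for all $x\in G$. (ii) If $|G|$ is even, the same conclusion holds with $2r+2$ replaced by $3r+3$.
   Context: Elements of $G$ are $r$-tuples $x=(x[1],\dots,x[r])$ with $x[k]\in\mathbb Z/a_k\mathbb Z$, and addition is componentwise modulo $a_k$ in the $k$-th coordinate. For a function $f:G\to\mathbb C$ and $n\ge 1$, the $n$-th order autocorrelation is $M_n(f;x_1,\dots,x_{n-1})=\sum_{y\in G}f(y)f(y+x_1)\cdots f(y+x_{n-1})$ for $x_1,\dots,x_{n-1}\in G$ (so $M_1(f)=\sum_{y\in G}f(y)$). *)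

theory Defs
  imports Complex_Main
begin

text \<open>The grid G = Z/a_1 x ... x Z/a_r, with the parameters given as a list a = [a_1,...,a_r]
  (indices shifted to 0..r-1). Elements are integer lists x of length r with 0 <= x!k < a!k.\<close>

definition grid :: "nat list \<Rightarrow> int list set" where
  "grid a = {x. length x = length a \<and> (\<forall>k<length a. 0 \<le> x!k \<and> x!k < int (a!k))}"

definition gadd :: "nat list \<Rightarrow> int list \<Rightarrow> int list \<Rightarrow> int list" where
  "gadd a x y = map (\<lambda>k. (x!k + y!k) mod int (a!k)) [0..<length a]"

text \<open>n-th order autocorrelation, n = length xs + 1:
  M_n(f; x_1..x_{n-1}) = sum_{y in G} f(y) f(y+x_1) ... f(y+x_{n-1}).\<close>
definition autocorr :: "nat list \<Rightarrow> (int list \<Rightarrow> rat) \<Rightarrow> int list list \<Rightarrow> rat" where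
  "autocorr a f xs = (\<Sum>y\<in>grid a. f y * prod_list (map (\<lambda>x. f (gadd a y x)) xs))"

definition same_autocorr_upto :: "nat list \<Rightarrow> nat \<Rightarrow> (int list \<Rightarrow> rat) \<Rightarrow> (int list \<Rightarrow> rat) \<Rightarrow> bool" where
  "same_autocorr_upto a N f g \<longleftrightarrow>
     (\<forall>n. 1 \<le> n \<and> n \<le> N \<longrightarrow>
        (\<forall>xs. length xs = n - 1 \<and> set xs \<subseteq> grid a \<longrightarrow> autocorr a g xs = autocorr a f xs))"

end

(*
  On the Fourier side the autocorrelations of order n are the products of n Fourier coefficients
  over characters with trivial product. So f and g have Fourier coefficients with the same support
  S, and the quotient h of their coefficients on S is multiplicative along relations of length at
  most N. It suffices that h is multiplicative along all relations between elements of S, since h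
  is then evaluation at a point y of the grid.

  For rational f, irreducibility of the cyclotomic polynomials makes S closed under multiplication
  by units modulo m = |G|. Every integer is a sum of k units modulo m, where k = 2 for odd and k = 3
  for even m. Hence an integer multiple of an element of S costs only k terms: all relations
  involving at most r + 1 elements of S, with arbitrary coefficients, are respected if
  N = k (r + 1). Since r + 1 vectors in Z^r are linearly dependent, these generate, one prime at a
  time, all relations.
*)
theory Submission
  imports Defs "HOL-Number_Theory.Number_Theory"
begin

subsection \<open>Vanishing sums of roots of unity\<close>

text \<open>For \<open>m > 0\<close> this is the ring of integers extended by the
  \<open>m\<close>-th roots of unity. It is built one signed root at a time so that closure
  properties and integrality follow by induction.\<close>

inductive_set root_span :: "nat \<Rightarrow> complex set" for m where
  zero: "0 \<in> root_span m"
| add: "x \<in> root_span m \<Longrightarrow> z ^ m = 1 \<Longrightarrow> x + z \<in> root_span m"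
| diff: "x \<in> root_span m \<Longrightarrow> z ^ m = 1 \<Longrightarrow> x - z \<in> root_span m"

lemma root_span_root: "z ^ m = 1 \<Longrightarrow> z \<in> root_span m"
  using root_span.add[OF root_span.zero] by fastforce

lemma root_span_plus:
  assumes "y \<in> root_span m" "x \<in> root_span m"
  shows "x + y \<in> root_span m"
  using assms
proof (induction)
  case (add y z)
  then show ?case using root_span.add[of "x + y" m z] by (simp add: add.assoc)
next
  case (diff y z)
  then show ?case using root_span.diff[of "x + y" m z] by (simp add: algebra_simps)
qed simp

lemma root_span_uminus:
  assumes "x \<in> root_span m"
  shows "- x \<in> root_span m"
  using assms
proof (induction)
  case (add x z)
  then show ?case using root_span.diff[of "- x" m z] by simp
next
  case (diff x z)
  then show ?case using root_span.add[of "- x" m z] by simp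
qed (simp add: root_span.zero)

lemma root_span_minus: "x \<in> root_span m \<Longrightarrow> y \<in> root_span m \<Longrightarrow> x - y \<in> root_span m"
  using root_span_plus[OF root_span_uminus] by fastforce

lemma root_span_mult_root:
  assumes "x \<in> root_span m" "w ^ m = 1"
  shows "x * w \<in> root_span m"
  using assms
proof (induction)
  case (add x z)
  then show ?case using root_span.add[of "x * w" m "z * w"] by (simp add: algebra_simps)
next
  case (diff x z)
  then show ?case using root_span.diff[of "x * w" m "z * w"] by (simp add: algebra_simps)
qed (simp add: root_span.zero)

lemma root_span_mult:
  assumes "y \<in> root_span m" "x \<in> root_span m"
  shows "x * y \<in> root_span m"
  using assms
  by induction
    (auto simp: distrib_left right_diff_distrib
      intro: root_span_plus root_span_minus root_span_mult_root root_span.zero)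

lemma root_span_power: "x \<in> root_span m \<Longrightarrow> x ^ n \<in> root_span m"
  by (induction n) (auto intro: root_span_mult root_span_root)

lemma root_span_sum: "(\<And>i. i \<in> I \<Longrightarrow> x i \<in> root_span m) \<Longrightarrow> sum x I \<in> root_span m"
  by (induction I rule: infinite_finite_induct) (auto intro: root_span_plus root_span.zero)

lemma root_span_of_nat: "of_nat n \<in> root_span m"
  by (induction n) (simp_all add: root_span_plus root_span_root root_span.zero)

lemma root_span_of_int: "of_int n \<in> root_span m"
  using root_span_of_nat root_span_uminus by (cases n rule: int_cases2) auto

text \<open>The inner binomial coefficients are divisible by \<open>p\<close>. The cofactor
  \<open>z\<close> stays in \<open>root_span m\<close>, since divisibility by \<open>p\<close> says
  nothing among all complex numbers.\<close>

lemma root_span_freshman: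
  assumes p: "prime p" and "x \<in> root_span m" "y \<in> root_span m"
  shows "\<exists>z\<in>root_span m. (x + y) ^ p = x ^ p + y ^ p + of_nat p * z"
proof -
  let ?t = "\<lambda>k. of_nat ((p choose k) div p) * x ^ k * y ^ (p - k)"
  have p1: "p > 1" using p by (rule prime_gt_1_nat)
  have "(x + y) ^ p = (\<Sum>k\<in>{..p}. of_nat (p choose k) * x ^ k * y ^ (p - k))"
    by (simp add: binomial_ring)
  also have "{..p} = insert 0 (insert p {0<..<p})" by auto
  also have "(\<Sum>k\<in>insert 0 (insert p {0<..<p}). of_nat (p choose k) * x ^ k * y ^ (p - k))
      = x ^ p + y ^ p + (\<Sum>k\<in>{0<..<p}. of_nat (p choose k) * x ^ k * y ^ (p - k))"
    using p1 by (simp add: algebra_simps)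
  also have "(\<Sum>k\<in>{0<..<p}. of_nat (p choose k) * x ^ k * y ^ (p - k)) = (\<Sum>k\<in>{0<..<p}. of_nat p * ?t k)"
  proof (rule sum.cong[OF refl])
    fix k assume "k \<in> {0<..<p}"
    then have "p dvd (p choose k)" using p by (auto intro: dvd_choose_prime)
    then have "(of_nat (p choose k) :: complex) = of_nat p * of_nat ((p choose k) div p)"
      by (metis dvd_mult_div_cancel of_nat_mult)
    then show "of_nat (p choose k) * x ^ k * y ^ (p - k) = of_nat p * ?t k" by simp
  qed
  also have "\<dots> = of_nat p * (\<Sum>k\<in>{0<..<p}. ?t k)" by (simp add: sum_distrib_left)
  finally show ?thesis
    using assms by (intro bexI[of _ "\<Sum>k\<in>{0<..<p}. ?t k"])
      (simp_all add: root_span_sum root_span_mult root_span_power root_span_of_nat)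
qed

text \<open>Adding one term at a time reduces this to the congruence for two summands; Fermat's
  little theorem turns \<open>c i ^ p\<close> back into \<open>c i\<close>.\<close>

lemma root_span_frobenius:
  fixes c :: "'i \<Rightarrow> int"
  assumes p: "prime p" and "finite I" and z: "\<And>i. i \<in> I \<Longrightarrow> z i ^ m = 1"
  shows "\<exists>w\<in>root_span m. (\<Sum>i\<in>I. of_int (c i) * z i) ^ p = (\<Sum>i\<in>I. of_int (c i) * z i ^ p) + of_nat p * w"
  using \<open>finite I\<close> z
proof (induction rule: finite_induct)
  case empty
  then show ?case using p by (intro bexI[of _ 0]) (auto simp: root_span.zero prime_gt_0_nat)
next
  case (insert i I)
  let ?s = "\<Sum>i\<in>I. of_int (c i) * z i"
  obtain w where w: "w \<in> root_span m" "?s ^ p = (\<Sum>i\<in>I. of_int (c i) * z i ^ p) + of_nat p * w"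
    using insert by auto
  have s: "?s \<in> root_span m"
    using insert.prems by (intro root_span_sum root_span_mult root_span_of_int root_span_root) auto
  have "of_int (c i) * z i \<in> root_span m"
    using insert.prems by (intro root_span_mult root_span_of_int root_span_root) auto
  from root_span_freshman[OF p this s] obtain w' where w': "w' \<in> root_span m"
    "(of_int (c i) * z i + ?s) ^ p = (of_int (c i) * z i) ^ p + ?s ^ p + of_nat p * w'" by blast
  have "[c i ^ p = c i] (mod (int p))"
  proof (cases "int p dvd c i")
    case True
    then have "int p dvd c i ^ p" using p prime_gt_0_nat by (metis dvd_power dvd_power_same dvd_trans)
    then show ?thesis using True by (simp add: cong_def dvd_eq_mod_eq_0)
  next
    case False
    have "[c i ^ (p - 1) = 1] (mod (int p))"
    proof -
      \<comment> \<open>\<open>fermat_theorem\<close> is about natural numbers, hence a natural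
        representative of \<open>c i\<close>.\<close>
      let ?x = "nat (c i mod int p)"
      have x: "[int ?x = c i] (mod int p)" using p by (simp add: cong_def prime_gt_0_nat)
      have "\<not> p dvd ?x"
        using False x p by (metis cong_dvd_iff int_dvd_int_iff)
      then have "[?x ^ (p - 1) = 1] (mod p)" using p fermat_theorem by blast
      then have "[int ?x ^ (p - 1) = 1] (mod int p)" by (metis cong_int_iff of_nat_1 of_nat_power)
      then show ?thesis using x by (meson cong_pow cong_sym cong_trans)
    qed
    then have "[c i ^ (p - 1) * c i = 1 * c i] (mod (int p))" by (rule cong_mult) simp
    then show ?thesis using p by (simp only: prime_gt_0_nat power_minus_mult mult_1)
  qed
  then obtain d where "c i ^ p = c i + int p * d" by (metis cong_iff_lin cong_sym mult.commute)
  then have "(of_int (c i) :: complex) ^ p = of_int (c i) + of_nat p * of_int d"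
    by (metis of_int_add of_int_mult of_int_of_nat_eq of_int_power)
  then have "(of_int (c i) * z i + ?s) ^ p = of_int (c i) * z i ^ p + (\<Sum>i\<in>I. of_int (c i) * z i ^ p)
      + of_nat p * (of_int d * z i ^ p + w + w')"
    using w' w by (simp add: power_mult_distrib algebra_simps)
  moreover have "of_int d * z i ^ p + w + w' \<in> root_span m"
    using insert.prems w(1) w'(1)
    by (simp add: root_span_plus root_span_mult root_span_of_int root_span_power root_span_root)
  ultimately show ?case using insert by auto
qed

section \<open>Bounding the prime divisors of an element of \<open>root_span m\<close>\<close>

lemma rat_functional:
  fixes x :: complex
  assumes "x \<noteq> 0"
  shows "\<exists>l :: complex \<Rightarrow> rat. (\<forall>u v. l (u + v) = l u + l v) \<and> (\<forall>q u. l (of_rat q * u) = q * l u) \<and> l x = 1"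
proof -
  interpret C: vector_space "\<lambda>(q::rat) (u::complex). of_rat q * u"
    by unfold_locales (auto simp: algebra_simps of_rat_add of_rat_mult)
  interpret R: vector_space "(*) :: rat \<Rightarrow> rat \<Rightarrow> rat"
    by unfold_locales (auto simp: algebra_simps)
  interpret vector_space_pair "\<lambda>(q::rat) (u::complex). of_rat q * u" "(*) :: rat \<Rightarrow> rat \<Rightarrow> rat" ..
  have "C.independent {x}" using assms C.independent_insert[of x "{}"] by simp
  from linear_independent_extend[OF this, of "\<lambda>_. 1"] obtain l where
    l: "Vector_Spaces.linear (\<lambda>(q::rat) (u::complex). of_rat q * u) (*) l" "l x = 1" by auto
  interpret l: Vector_Spaces.linear "\<lambda>(q::rat) (u::complex). of_rat q * u" "(*)" l by fact
  show ?thesis using l(2) l.add l.scale by blast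
qed

lemma rat_common_denominator:
  fixes q :: "'i \<Rightarrow> rat"
  assumes "finite I"
  shows "\<exists>D::nat. D > 0 \<and> (\<forall>i\<in>I. of_nat D * q i \<in> \<int>)"
  using assms
proof (induction)
  case (insert i I)
  then obtain D where D: "D > 0" "\<forall>i\<in>I. of_nat D * q i \<in> \<int>" by auto
  obtain a b where ab: "quotient_of (q i) = (a, b)" by fastforce
  have b: "b > 0" using ab quotient_of_denom_pos by blast
  have "of_int b * q i = of_int a" using quotient_of_div[OF ab] b by simp
  then have "of_int b * q i \<in> \<int>" using Ints_of_int by metis
  then have "of_nat D * (of_int b * q i) \<in> \<int>" by (rule Ints_mult[rotated]) simp
  moreover have "of_int b * (of_nat D * q j) \<in> \<int>" if "j \<in> I" for j
    using that D by (auto intro: Ints_mult)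
  ultimately have "\<forall>j\<in>insert i I. of_nat (D * nat b) * q j \<in> \<int>"
    using b by (simp add: mult_ac)
  then show ?case using D(1) b by (intro exI[of _ "D * nat b"]) simp
qed auto

text \<open>A \<open>\<rat>\<close>-linear functional with value 1 at \<open>x\<close> takes values with a common denominator on
  the lattice \<open>root_span m\<close>.\<close>
lemma root_span_prime_divisors_bounded:
  assumes "m > 0" "x \<noteq> 0"
  shows "\<exists>D::nat. \<forall>p>D. \<forall>z\<in>root_span m. x \<noteq> of_nat p * z"
proof -
  obtain l :: "complex \<Rightarrow> rat" where add: "\<And>u v. l (u + v) = l u + l v"
    and scale: "\<And>q u. l (of_rat q * u) = q * l u" and lx: "l x = 1"
    using rat_functional[OF assms(2)] by blast
  have "finite {z :: complex. z ^ m = 1}" using assms by (intro finite_roots_unity) simp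
  then obtain D :: nat where D: "D > 0" "\<And>z. z ^ m = 1 \<Longrightarrow> of_nat D * l z \<in> \<int>"
    using rat_common_denominator[of "{z. z ^ m = 1}" l] by auto
  have diff: "l (u - v) = l u - l v" for u v using add[of "u - v" v] by simp
  have int: "of_nat D * l z \<in> \<int>" if "z \<in> root_span m" for z
    using that
  proof induction
    case zero
    then show ?case using scale[of 0 0] by simp
  qed (auto simp: add diff distrib_left right_diff_distrib D)
  have False if "p > D" "z \<in> root_span m" "x = of_nat p * z" for p z
  proof -
    have "l x = of_nat p * l z" using scale[of "of_nat p" z] that by simp
    \<comment> \<open>As \<open>D * l z\<close> is an integer, \<open>p\<close> would divide the
      smaller positive number \<open>D\<close>.\<close>
    then have "of_nat D = of_nat p * (of_nat D * l z)" using lx by (simp add: algebra_simps)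
    moreover obtain d where "of_nat D * l z = of_int d" using int[OF \<open>z \<in> root_span m\<close>] by (auto elim: Ints_cases)
    ultimately have "(of_int (int D) :: rat) = of_int (int p * d)" by simp
    then have "int D = int p * d" using of_int_eq_iff by blast
    then have "p dvd D" by (metis dvd_triv_left int_dvd_int_iff)
    then show False using \<open>p > D\<close> D(1) by (auto dest: dvd_imp_le)
  qed
  then show ?thesis by (intro exI[of _ D]) auto
qed

text \<open>Landau's proof of the irreducibility of cyclotomic polynomials: conjugation by a large
  prime preserves vanishing because of the Frobenius congruence, and every class coprime
  to \<open>m\<close> has a representative without small prime factors.\<close>
lemma root_sum_conjugate_int:
  fixes c :: "'i \<Rightarrow> int" and z :: "'i \<Rightarrow> complex"
  assumes m: "m > 0" and fin: "finite I" and z: "\<And>i. i \<in> I \<Longrightarrow> z i ^ m = 1"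
    and sum0: "(\<Sum>i\<in>I. of_int (c i) * z i) = 0" and t: "coprime t m"
  shows "(\<Sum>i\<in>I. of_int (c i) * z i ^ t) = 0"
proof -
  define \<alpha> where "\<alpha> u = (\<Sum>i\<in>I. of_int (c i) * z i ^ u)" for u :: nat
  have mod: "z i ^ u = z i ^ (u mod m)" if "i \<in> I" for u i
    using z[OF that] by (metis mult_div_mod_eq mult_1 power_add power_mult power_one)
  have \<alpha>_cong: "\<alpha> u = \<alpha> v" if "u mod m = v mod m" for u v
    unfolding \<alpha>_def using that mod by (metis (no_types, lifting) sum.cong)
  \<comment> \<open>The bound can only concern nonzero sums, because 0 is divisible by every
    prime.\<close>
  have "\<exists>D::nat. \<forall>p>D. \<forall>w\<in>root_span m. \<alpha> u \<noteq> 0 \<longrightarrow> \<alpha> u \<noteq> of_nat p * w" for u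
    using root_span_prime_divisors_bounded[OF m, of "\<alpha> u"] by (cases "\<alpha> u = 0") auto
  then obtain D :: "nat \<Rightarrow> nat" where
    D: "\<And>u p w. p > D u \<Longrightarrow> w \<in> root_span m \<Longrightarrow> \<alpha> u \<noteq> 0 \<Longrightarrow> \<alpha> u \<noteq> of_nat p * w" by metis
  \<comment> \<open>Exponents matter only modulo \<open>m\<close>, so finitely many bounds have a
    common maximum.\<close>
  define A where "A = Max (D ` {..<m})"
  have A: "D (u mod m) \<le> A" for u using m by (auto simp: A_def)
  have step: "\<alpha> (u * p) = 0" if "\<alpha> u = 0" "prime p" "p > A" for u p
  proof (rule ccontr)
    assume ne: "\<alpha> (u * p) \<noteq> 0"
    have "(z i ^ u) ^ m = 1" if "i \<in> I" for i using z[OF that] by (metis mult.commute power_mult power_one)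
    then obtain w where "w \<in> root_span m" "\<alpha> u ^ p = \<alpha> (u * p) + of_nat p * w"
      using root_span_frobenius[OF \<open>prime p\<close> fin, of "\<lambda>i. z i ^ u" m c]
      by (auto simp: \<alpha>_def power_mult)
    then have "\<alpha> (u * p mod m) = of_nat p * (- w)" "- w \<in> root_span m"
      using that prime_gt_0_nat[OF \<open>prime p\<close>] \<alpha>_cong[of "u * p mod m" "u * p"]
      by (auto simp: root_span_uminus add_eq_0_iff2 power_0_left)
    then show False using D[of "u * p mod m" p "- w"] A[of "u * p"] that ne
        \<alpha>_cong[of "u * p mod m" "u * p"] by simp
  qed
  have large: "\<alpha> u = 0" if "\<forall>p. prime p \<longrightarrow> p dvd u \<longrightarrow> p > A" "u > 0" for u
    using that
  proof (induction u rule: less_induct)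
    case (less u)
    show ?case
    proof (cases "u = 1")
      case True
      then show ?thesis using sum0 by (simp add: \<alpha>_def)
    next
      case False
      then obtain p where p: "prime p" "p dvd u" using prime_factor_nat by blast
      then obtain v where v: "u = v * p" by (metis dvdE mult.commute)
      then have "v < u" "v > 0" using p less.prems(2) prime_gt_1_nat[OF p(1)] by auto
      then have "\<alpha> v = 0" using less v by auto
      then show ?thesis using step p less.prems(1) v by blast
    qed
  qed
  \<comment> \<open>The number \<open>t + m * M\<close> is congruent to \<open>t\<close> modulo
    \<open>m\<close> and has no prime factor \<open>q \<le> A\<close>: if \<open>q\<close> divides
    \<open>t\<close>, it divides neither \<open>m\<close> nor \<open>M\<close>; otherwise it divides
    \<open>M\<close> but not \<open>t\<close>.\<close>
  define M where "M = \<Prod>{q. prime q \<and> q \<le> A \<and> \<not> q dvd t}"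
  have finM: "finite {q. prime q \<and> q \<le> A \<and> \<not> q dvd t}" by simp
  have M0: "M > 0" unfolding M_def by (auto intro!: prod_pos prime_gt_0_nat)
  have "q > A" if "prime q" "q dvd t + m * M" for q
  proof (rule ccontr)
    assume "\<not> q > A"
    show False
    proof (cases "q dvd t")
      case True
      then have "q dvd m * M" using \<open>q dvd t + m * M\<close> dvd_add_right_iff by blast
      then consider "q dvd m" | "q dvd M" using prime_dvd_multD[OF \<open>prime q\<close>] by blast
      then show False
      proof cases
        case 1
        then show False using True t \<open>prime q\<close> coprime_common_divisor[of t m q] by auto
      next
        case 2
        then obtain q' where "prime q'" "\<not> q' dvd t" "q dvd q'"
          using prime_dvd_prod_iff[OF finM \<open>prime q\<close>, of "\<lambda>x. x"] unfolding M_def by auto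
        then show False using True primes_dvd_imp_eq[OF \<open>prime q\<close>] by blast
      qed
    next
      case False
      then have "q dvd M" using dvd_prodI[OF finM, of q "\<lambda>x. x"] \<open>\<not> q > A\<close> \<open>prime q\<close> by (simp add: M_def)
      then show False using False \<open>q dvd t + m * M\<close> dvd_add_left_iff[of q "m * M" t] by simp
    qed
  qed
  then have "\<alpha> (t + m * M) = 0" using large M0 m by simp
  then show ?thesis using \<alpha>_cong[of "t + m * M" t] by (simp add: \<alpha>_def)
qed

text \<open>A common denominator reduces this to integer coefficients.\<close>

lemma root_sum_conjugate:
  fixes c :: "'i \<Rightarrow> rat" and z :: "'i \<Rightarrow> complex"
  assumes "m > 0" "finite I" "\<And>i. i \<in> I \<Longrightarrow> z i ^ m = 1"
    and sum0: "(\<Sum>i\<in>I. of_rat (c i) * z i) = 0" and "coprime t m"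
  shows "(\<Sum>i\<in>I. of_rat (c i) * z i ^ t) = 0"
proof -
  obtain D :: nat where D: "D > 0" "\<forall>i\<in>I. of_nat D * c i \<in> \<int>"
    using rat_common_denominator[OF assms(2)] by blast
  have "\<exists>k::int. of_nat D * c i = of_int k" if "i \<in> I" for i
    using D(2) that by (auto elim: Ints_cases)
  then obtain d :: "'i \<Rightarrow> int" where d: "\<And>i. i \<in> I \<Longrightarrow> of_nat D * c i = of_int (d i)"
    by metis
  have dD: "of_int (d i) = (of_nat D * of_rat (c i) :: complex)" if "i \<in> I" for i
    using arg_cong[OF d[OF that], of "of_rat :: rat \<Rightarrow> complex"] by (simp add: of_rat_mult)
  have "(\<Sum>i\<in>I. of_int (d i) * w i) = of_nat D * (\<Sum>i\<in>I. of_rat (c i) * w i)" for w :: "'i \<Rightarrow> complex"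
    unfolding sum_distrib_left using dD by (intro sum.cong) auto
  then show ?thesis
    using root_sum_conjugate_int[OF assms(1-3), where c = d and t = t] sum0 assms(5) D(1) by simp
qed

subsection \<open>Sums of units\<close>

lemma coprime_if_no_common_prime:
  fixes u m :: int
  assumes "m \<noteq> 0" "\<And>p. prime p \<Longrightarrow> p dvd m \<Longrightarrow> \<not> p dvd u"
  shows "coprime u m"
proof (rule ccontr)
  assume "\<not> coprime u m"
  then have "gcd u m \<noteq> 0" "\<not> is_unit (gcd u m)" using assms(1) by (auto simp: is_unit_gcd)
  then obtain p where "prime p" "p dvd gcd u m" by (rule prime_divisorE)
  then show False using assms(2) by auto
qed

text \<open>The Chinese remainder theorem over the primes dividing \<open>m\<close>, for a condition
  that depends only on the residue modulo each of them.\<close>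

lemma simultaneous_residues:
  fixes m :: int and Q :: "int \<Rightarrow> int \<Rightarrow> bool"
  assumes "m \<noteq> 0"
    and ex: "\<And>p. prime p \<Longrightarrow> p dvd m \<Longrightarrow> \<exists>x. Q p x"
    and cong: "\<And>p x y. prime p \<Longrightarrow> p dvd m \<Longrightarrow> [x = y] (mod p) \<Longrightarrow> Q p x \<Longrightarrow> Q p y"
  shows "\<exists>u. \<forall>p. prime p \<longrightarrow> p dvd m \<longrightarrow> Q p u"
proof -
  define A where "A = {p :: nat. prime p \<and> int p dvd m}"
  obtain f where f: "\<And>p. prime p \<Longrightarrow> p dvd m \<Longrightarrow> Q p (f p)" using ex by metis
  have "int ` A \<subseteq> {d. d dvd m}" by (auto simp: A_def)
  then have "finite A" using assms(1) finite_imageD[of int A] finite_subset finite_divisors_int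
    by (metis inj_on_of_nat)
  moreover have "\<forall>i\<in>A. \<forall>j\<in>A. i \<noteq> j \<longrightarrow> coprime i j" by (auto simp: A_def primes_coprime)
  ultimately obtain x where x: "\<And>p. p \<in> A \<Longrightarrow> [x = nat (f (int p) mod int p)] (mod p)"
    using chinese_remainder_nat[of A "\<lambda>p. p" "\<lambda>p. nat (f (int p) mod int p)"] by auto
  have "Q p (int x)" if p: "prime p" "p dvd m" for p
  proof -
    have p': "p = int (nat p)" "nat p \<in> A" using p by (auto simp: A_def prime_ge_0_int)
    have "[int x = int (nat (f p mod p))] (mod p)" using x[OF p'(2)] p'(1) by (metis cong_int_iff)
    moreover have "int (nat (f p mod p)) = f p mod p" using p prime_gt_0_int by auto
    ultimately have "[f p = int x] (mod p)" by (simp add: cong_def)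
    then show ?thesis using cong p f by blast
  qed
  then show ?thesis by blast
qed

text \<open>Modulo a prime \<open>p\<close> dividing \<open>m\<close>, one of 1 and -1 serves as
  \<open>u\<close>: otherwise \<open>p\<close> divides both \<open>c - 1\<close> and
  \<open>c + 1\<close>, hence is 2, and then \<open>c\<close> is even and \<open>c - 1\<close>
  odd.\<close>

lemma units_sum_two:
  fixes m c :: int
  assumes "m \<noteq> 0" "even m \<Longrightarrow> even c"
  shows "\<exists>u. coprime u m \<and> coprime (c - u) m"
proof -
  have "\<exists>u. \<forall>p. prime p \<longrightarrow> p dvd m \<longrightarrow> \<not> p dvd u \<and> \<not> p dvd c - u"
  proof (rule simultaneous_residues[OF assms(1)])
    fix p :: int assume p: "prime p" "p dvd m"
    then have u: "\<not> p dvd 1" "\<not> p dvd - 1" by (auto simp: not_prime_unit)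
    show "\<exists>x. \<not> p dvd x \<and> \<not> p dvd c - x"
    proof (cases "p dvd c - 1")
      case True
      have "p \<noteq> 2" using True p(2) assms(2) by auto
      then have "\<not> p dvd 2" using p(1) primes_dvd_imp_eq[of p 2] by auto
      then have "\<not> p dvd c - (- 1)" using True dvd_diff[of p "c - (- 1)" "c - 1"] by auto
      then show ?thesis using u by blast
    qed (use u in blast)
  next
    fix p x y :: int assume "[x = y] (mod p)" "\<not> p dvd x \<and> \<not> p dvd c - x"
    moreover from this have "[c - x = c - y] (mod p)" by (simp add: cong_diff)
    ultimately show "\<not> p dvd y \<and> \<not> p dvd c - y" using cong_dvd_iff by blast
  qed
  then show ?thesis using coprime_if_no_common_prime[OF assms(1)] by blast
qed

text \<open>The residues 0, \<open>c\<close> and \<open>- v\<close> are forbidden for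
  \<open>u\<close>. Modulo a prime above 3, each of the last two excludes at most one of 1, 2, 3.
  Modulo 3 only the residue of \<open>v\<close> remains, and \<open>good\<close> says that it
  differs from \<open>c\<close>.\<close>

lemma units_sum_two_shift:
  fixes m c v :: int
  assumes "odd m" "coprime v m" and good: "3 dvd m \<Longrightarrow> \<not> 3 dvd c - v"
  shows "\<exists>u. coprime u m \<and> coprime (c - u) m \<and> coprime (u + v) m"
proof -
  have m: "m \<noteq> 0" using assms(1) by auto
  have "\<exists>u. \<forall>p. prime p \<longrightarrow> p dvd m \<longrightarrow> \<not> p dvd u \<and> \<not> p dvd c - u \<and> \<not> p dvd u + v"
  proof (rule simultaneous_residues[OF m])
    fix p :: int assume p: "prime p" "p dvd m"
    have p2: "p \<noteq> 2" using p(2) assms(1) by auto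
    have nu: "\<not> p dvd 1" using p by (auto simp: not_prime_unit)
    have n2: "\<not> p dvd 2" using p(1) p2 primes_dvd_imp_eq[of p 2] by auto
    show "\<exists>x. \<not> p dvd x \<and> \<not> p dvd c - x \<and> \<not> p dvd x + v"
    proof (cases "p = 3")
      case True
      have "\<not> 3 dvd v" using coprime_common_divisor[OF assms(2), of 3] p(2) True by auto
      moreover have "\<not> 3 dvd c - v" using good p(2) True by auto
      ultimately have "\<not> 3 dvd c - v \<and> \<not> 3 dvd v" by simp
      then have "(\<not> 3 dvd (1::int) \<and> \<not> 3 dvd c - 1 \<and> \<not> 3 dvd 1 + v) \<or>
                 (\<not> 3 dvd (2::int) \<and> \<not> 3 dvd c - 2 \<and> \<not> 3 dvd 2 + v)" by presburger
      then show ?thesis using True by blast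
    next
      case False
      then have n3: "\<not> p dvd 3" using p(1) primes_dvd_imp_eq[of p 3] by auto
      have d: "\<not> (p dvd x \<and> p dvd x + 1)" "\<not> (p dvd x \<and> p dvd x + 2)" for x
        using nu n2 dvd_add_right_iff[of p x 1] dvd_add_right_iff[of p x 2] by blast+
      have "\<not> (p dvd c - 1 \<and> p dvd c - 2)" "\<not> (p dvd c - 2 \<and> p dvd c - 3)" "\<not> (p dvd c - 1 \<and> p dvd c - 3)"
        using d(1)[of "c - 2"] d[of "c - 3"] by (simp_all add: conj_commute)
      moreover have "\<not> (p dvd 1 + v \<and> p dvd 2 + v)" "\<not> (p dvd 2 + v \<and> p dvd 3 + v)" "\<not> (p dvd 1 + v \<and> p dvd 3 + v)"
        using d[of "1 + v"] d(1)[of "2 + v"] by (simp_all add: add_ac)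
      ultimately have "(\<not> p dvd c - 1 \<and> \<not> p dvd 1 + v) \<or> (\<not> p dvd c - 2 \<and> \<not> p dvd 2 + v) \<or>
          (\<not> p dvd c - 3 \<and> \<not> p dvd 3 + v)" by blast
      then show ?thesis using nu n2 n3 by blast
    qed
  next
    fix p x y :: int assume *: "[x = y] (mod p)" "\<not> p dvd x \<and> \<not> p dvd c - x \<and> \<not> p dvd x + v"
    then have "[c - x = c - y] (mod p)" "[x + v = y + v] (mod p)" by (simp_all add: cong_diff cong_add)
    then show "\<not> p dvd y \<and> \<not> p dvd c - y \<and> \<not> p dvd y + v" using * cong_dvd_iff by blast
  qed
  then show ?thesis using coprime_if_no_common_prime[OF m] by blast
qed

subsection \<open>Linear dependence over the integers\<close>

text \<open>Gaussian elimination without division: the last coordinate is cleared by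
  cross-multiplying with a pivot vector \<open>w b0\<close>.\<close>

lemma integer_dependence:
  fixes w :: "'b \<Rightarrow> nat \<Rightarrow> int"
  assumes "finite B" "card B > r"
  shows "\<exists>c. (\<forall>j<r. (\<Sum>b\<in>B. c b * w b j) = 0) \<and> (\<exists>b\<in>B. c b \<noteq> 0)"
  using assms
proof (induction r arbitrary: B w)
  case 0
  then have "B \<noteq> {}" by auto
  then show ?case by (intro exI[of _ "\<lambda>_. 1"]) auto
next
  case (Suc r)
  show ?case
  proof (cases "\<forall>b\<in>B. w b r = 0")
    case True
    obtain c where "\<forall>j<r. (\<Sum>b\<in>B. c b * w b j) = 0" "\<exists>b\<in>B. c b \<noteq> 0"
      using Suc.IH[of B w] Suc.prems by auto
    then show ?thesis using True by (intro exI[of _ c]) (auto simp: less_Suc_eq)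
  next
    case False
    then obtain b0 where b0: "b0 \<in> B" "w b0 r \<noteq> 0" by blast
    let ?B = "B - {b0}"
    have "card ?B > r" using Suc.prems b0 by auto
    then obtain c where c: "\<forall>j<r. (\<Sum>b\<in>?B. c b * (w b0 r * w b j - w b r * w b0 j)) = 0"
      "\<exists>b\<in>?B. c b \<noteq> 0"
      using Suc.IH[of ?B "\<lambda>b j. w b0 r * w b j - w b r * w b0 j"] Suc.prems(1) by blast
    \<comment> \<open>A dependence of the reduced vectors is rewritten in the original ones by
      collecting the multiples of the pivot; in coordinate \<open>r\<close> every reduced vector is
      0.\<close>
    define c' where "c' b = (if b = b0 then - (\<Sum>b\<in>?B. c b * w b r) else w b0 r * c b)" for b
    have eq: "(\<Sum>b\<in>B. c' b * w b j) = (\<Sum>b\<in>?B. c b * (w b0 r * w b j - w b r * w b0 j))" for j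
    proof -
      have "(\<Sum>b\<in>B. c' b * w b j) = c' b0 * w b0 j + (\<Sum>b\<in>?B. c' b * w b j)"
        using Suc.prems(1) b0(1) by (rule sum.remove)
      also have "(\<Sum>b\<in>?B. c' b * w b j) = (\<Sum>b\<in>?B. c b * (w b0 r * w b j))"
        by (rule sum.cong) (auto simp: c'_def)
      also have "c' b0 * w b0 j = - (\<Sum>b\<in>?B. c b * (w b r * w b0 j))"
        by (simp add: c'_def sum_distrib_right mult.assoc)
      finally show ?thesis by (simp add: right_diff_distrib sum_subtractf)
    qed
    have "(\<Sum>b\<in>B. c' b * w b j) = 0" if "j < Suc r" for j
      using c(1) that by (cases "j = r") (auto simp: eq)
    moreover have "\<exists>b\<in>B. c' b \<noteq> 0" using c(2) b0(2) by (auto simp: c'_def)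
    ultimately show ?thesis by blast
  qed
qed

text \<open>While \<open>p\<close> divides all coefficients they can be divided by \<open>p\<close>;
  the sum of their absolute values decreases, so this stops.\<close>

lemma integer_dependence_primitive:
  fixes w :: "'b \<Rightarrow> nat \<Rightarrow> int" and p :: int
  assumes "finite B" "card B > r" "p > 1"
  shows "\<exists>c. (\<forall>j<r. (\<Sum>b\<in>B. c b * w b j) = 0) \<and> (\<exists>b\<in>B. \<not> p dvd c b)"
proof -
  have "\<exists>c. (\<forall>j<r. (\<Sum>b\<in>B. c b * w b j) = 0) \<and> (\<exists>b\<in>B. \<not> p dvd c b)"
    if "\<forall>j<r. (\<Sum>b\<in>B. c b * w b j) = 0" "\<exists>b\<in>B. c b \<noteq> 0" for c
    using that
  proof (induction "\<Sum>b\<in>B. nat \<bar>c b\<bar>" arbitrary: c rule: less_induct)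
    case less
    show ?case
    proof (cases "\<exists>b\<in>B. \<not> p dvd c b")
      case True
      then show ?thesis using less.prems by blast
    next
      case False
      define d where "d b = c b div p" for b
      have cd: "c b = p * d b" if "b \<in> B" for b using False that by (auto simp: d_def)
      have "(\<Sum>b\<in>B. c b * w b j) = p * (\<Sum>b\<in>B. d b * w b j)" for j
        unfolding sum_distrib_left using cd by (intro sum.cong) auto
      then have d0: "\<forall>j<r. (\<Sum>b\<in>B. d b * w b j) = 0" using less.prems(1) assms(3) by auto
      obtain b where b: "b \<in> B" "c b \<noteq> 0" using less.prems(2) by blast
      then have db: "d b \<noteq> 0" using cd by auto
      have le: "nat \<bar>d b\<bar> \<le> nat \<bar>c b\<bar>" if "b \<in> B" for b
        using cd[OF that] assms(3) mult_right_mono[of 1 p "\<bar>d b\<bar>"] by (simp add: abs_mult)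
      have "nat \<bar>d b\<bar> < nat \<bar>c b\<bar>"
        using cd[OF b(1)] assms(3) db mult_strict_right_mono[of 1 p "\<bar>d b\<bar>"] by (simp add: abs_mult)
      then have "(\<Sum>b\<in>B. nat \<bar>d b\<bar>) < (\<Sum>b\<in>B. nat \<bar>c b\<bar>)"
        using le b(1) assms(1) by (intro sum_strict_mono_ex1) auto
      then show ?thesis using less.hyps[OF _ d0] db b(1) by blast
    qed
  qed
  then show ?thesis using integer_dependence[OF assms(1,2), of w] by blast
qed

subsection \<open>From short relations to all relations\<close>

text \<open>Unreduced integer vectors represent elements of the grid and also its characters, which
  allows integer linear algebra; \<open>null_vec\<close> says that the represented element is
  0.\<close>

definition null_vec :: "nat list \<Rightarrow> (nat \<Rightarrow> int) \<Rightarrow> bool" where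
  "null_vec a v \<longleftrightarrow> (\<forall>i<length a. int (a ! i) dvd v i)"

lemma null_vecI: "(\<And>i. i < length a \<Longrightarrow> int (a ! i) dvd v i) \<Longrightarrow> null_vec a v"
  by (simp add: null_vec_def)

text \<open>The algebra without the Fourier analysis. \<open>S\<close> will be the support of the
  coefficients of \<open>f\<close>, and \<open>h\<close> the quotient of those of \<open>g\<close>
  by those of \<open>f\<close>. \<open>N\<close> bounds the length of the known relations, with
  repetitions counted, and \<open>k\<close> units suffice to write any integer.\<close>

locale short_relations =
  fixes a :: "nat list" and m :: int and S :: "(nat \<Rightarrow> int) set"
    and h :: "(nat \<Rightarrow> int) \<Rightarrow> complex" and k N :: nat
  assumes m_pos: "m > 0"
    and a_dvd: "i < length a \<Longrightarrow> int (a ! i) dvd m"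
    and unit_closed: "s \<in> S \<Longrightarrow> coprime u m \<Longrightarrow> (\<lambda>i. u * s i) \<in> S"
    and short_rel: "length ss \<le> N \<Longrightarrow> set ss \<subseteq> S \<Longrightarrow> null_vec a (\<lambda>i. \<Sum>s\<leftarrow>ss. s i) \<Longrightarrow>
       prod_list (map h ss) = 1"
    and a_nonempty: "length a \<ge> 1"
    and N: "k * (length a + 1) \<le> N"
    and k: "odd m \<and> k = 2 \<or> even m \<and> k = 3"
begin

section \<open>Products of \<open>h\<close> over unit multiples of one vector\<close>

definition units :: "int list \<Rightarrow> bool" where
  "units us \<longleftrightarrow> (\<forall>u\<in>set us. coprime u m)"

text \<open>The candidate for the power of \<open>h s\<close> with exponent
  \<open>sum_list us\<close>.\<close>

definition unit_prod :: "(nat \<Rightarrow> int) \<Rightarrow> int list \<Rightarrow> complex" where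
  "unit_prod s us = (\<Prod>u\<leftarrow>us. h (\<lambda>i. u * s i))"

lemma units_simps [simp]: "units []" "units (u # us) \<longleftrightarrow> coprime u m \<and> units us"
  by (auto simp: units_def)

lemma unit_prod_simps [simp]: "unit_prod s [] = 1" "unit_prod s (u # us) = h (\<lambda>i. u * s i) * unit_prod s us"
  by (auto simp: unit_prod_def)

lemma N_ge: "2 * k \<le> N"
proof -
  have "2 * k \<le> k * (length a + 1)" using a_nonempty mult_le_mono2[of 2 "length a + 1" k] by linarith
  then show ?thesis using N by linarith
qed

text \<open>A pair \<open>(s, us)\<close> stands for \<open>sum_list us\<close> times
  \<open>s\<close> at the cost of \<open>length us\<close> elements, since unit multiples of
  \<open>s\<close> lie in \<open>S\<close>.\<close>

lemma rel_units:
  assumes "\<And>s us. (s, us) \<in> set L \<Longrightarrow> s \<in> S \<and> units us"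
    and "(\<Sum>(s, us)\<leftarrow>L. length us) \<le> N"
    and "null_vec a (\<lambda>i. \<Sum>(s, us)\<leftarrow>L. sum_list us * s i)"
  shows "(\<Prod>(s, us)\<leftarrow>L. unit_prod s us) = 1"
proof -
  define ss where "ss = concat (map (\<lambda>(s, us). map (\<lambda>u i. u * s i) us) L)"
  have "length ss = (\<Sum>(s, us)\<leftarrow>L. length us)"
    unfolding ss_def by (induction L) auto
  moreover have "set ss \<subseteq> S" using assms(1) unit_closed unfolding ss_def units_def by fastforce
  moreover have "(\<Sum>s\<leftarrow>ss. s i) = (\<Sum>(s, us)\<leftarrow>L. sum_list us * s i)" for i
    unfolding ss_def by (induction L) (auto simp: o_def sum_list_mult_const)
  ultimately have "prod_list (map h ss) = 1" using short_rel[of ss] assms(2,3) by simp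
  moreover have "prod_list (map h ss) = (\<Prod>(s, us)\<leftarrow>L. unit_prod s us)"
    unfolding ss_def unit_prod_def by (induction L) (auto simp: o_def)
  ultimately show ?thesis by simp
qed

lemma unit_prod_uminus:
  assumes "s \<in> S" "units us"
  shows "unit_prod s us * unit_prod s (map uminus us) = 1"
  using assms(2)
proof (induction us)
  case (Cons u us)
  have "h (\<lambda>i. u * s i) * h (\<lambda>i. - u * s i) = 1"
    using rel_units[of "[(s, [u, - u])]"] assms(1) Cons.prems N_ge k by (auto simp: null_vec_def)
  then show ?case using Cons by (simp add: mult_ac)
qed simp

text \<open>The difference of the two sums is a relation with \<open>length us + length vs\<close>
  terms. Keeping this total within \<open>N\<close> is the difficulty in the lemmas that
  follow.\<close>

lemma unit_prod_cong:
  assumes "s \<in> S" "units us" "units vs" "length us + length vs \<le> N" "m dvd sum_list us - sum_list vs"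
  shows "unit_prod s us = unit_prod s vs"
proof -
  have "sum_list (map uminus vs) = - sum_list vs" by (induction vs) auto
  then have "null_vec a (\<lambda>i. \<Sum>(s, us)\<leftarrow>[(s, us), (s, map uminus vs)]. sum_list us * s i)"
    using assms(5) a_dvd by (auto simp: null_vec_def left_diff_distrib[symmetric] intro: dvd_trans)
  moreover have "units (map uminus vs)" using assms(3) by (auto simp: units_def)
  ultimately have "unit_prod s us * unit_prod s (map uminus vs) = 1"
    using rel_units[of "[(s, us), (s, map uminus vs)]"] assms by auto
  then show ?thesis using unit_prod_uminus[OF assms(1,3)]
    by (metis mult.commute mult.left_commute mult_1_right)
qed

lemma h_nonzero: "s \<in> S \<Longrightarrow> h s \<noteq> 0"
  using unit_prod_uminus[of s "[1]"] by auto

text \<open>Units modulo an even \<open>m\<close> are odd, so an odd \<open>c\<close> takes a third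
  unit, here 1.\<close>

lemma ex_units: "\<exists>us. units us \<and> length us \<le> k \<and> sum_list us = c"
proof (cases "even m \<longrightarrow> even c")
  case True
  then obtain u where "coprime u m" "coprime (c - u) m" using units_sum_two[of m c] m_pos by auto
  then show ?thesis using k by (intro exI[of _ "[u, c - u]"]) auto
next
  case False
  then obtain u where "coprime u m" "coprime (c - 1 - u) m" using units_sum_two[of m "c - 1"] m_pos by auto
  then show ?thesis using k False by (intro exI[of _ "[1, u, c - 1 - u]"]) auto
qed

lemma units_parity:
  assumes "even m" "units us"
  shows "even (sum_list us) \<longleftrightarrow> even (length us)"
  using assms(2)
proof (induction us)
  case (Cons u us)
  then have "odd u" using assms(1) coprime_common_divisor[of u m 2] by auto
  then show ?case using Cons by auto
qed simp

text \<open>Comparing \<open>vs\<close> with \<open>v # us\<close> can take five terms, but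
  \<open>N_ge\<close> guarantees only four. Choosing \<open>u\<close> such that \<open>u + v\<close>
  is a unit too splits the comparison into three relations of at most four terms.\<close>

lemma unit_prod_add_unit_aux:
  assumes "odd m" "s \<in> S" "units us" "units vs" "length us \<le> k" "length vs \<le> k"
    and "coprime v m" "sum_list vs = sum_list us + v" "3 dvd m \<Longrightarrow> \<not> 3 dvd sum_list us - v"
  shows "unit_prod s vs = unit_prod s us * h (\<lambda>i. v * s i)"
proof -
  have k: "k = 2" using k assms(1) by auto
  note Ng = N_ge[unfolded k]
  obtain u where u: "coprime u m" "coprime (sum_list us - u) m" "coprime (u + v) m"
    using units_sum_two_shift[OF assms(1,7,9)] by blast
  have "unit_prod s us = unit_prod s [u, sum_list us - u]"
    using assms u k Ng by (intro unit_prod_cong) auto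
  moreover have "unit_prod s vs = unit_prod s [u + v, sum_list us - u]"
    using assms u k Ng by (intro unit_prod_cong) auto
  moreover have "unit_prod s [u + v] = unit_prod s [u, v]"
    using assms u k Ng by (intro unit_prod_cong) auto
  ultimately show ?thesis by simp
qed

lemma unit_prod_add_unit:
  assumes "s \<in> S" "units us" "units vs" "length us \<le> k" "length vs \<le> k"
    and "coprime v m" "sum_list vs = sum_list us + v"
  shows "unit_prod s vs = unit_prod s us * h (\<lambda>i. v * s i)"
proof (cases "even m")
  case True
  then have "odd v" using assms(6) coprime_common_divisor[of v m 2] by auto
  then have "even (length vs) \<longleftrightarrow> odd (length us)"
    using assms units_parity[OF True assms(2)] units_parity[OF True assms(3)] by auto
  \<comment> \<open>The two lengths differ in parity, so together with \<open>v\<close> there are at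
    most 3 + 2 + 1 terms, which is \<open>2 * k\<close>.\<close>
  then have "length us \<noteq> 3 \<or> length vs \<noteq> 3" by auto
  then have "length (v # us) + length vs \<le> N" using assms(4,5) N_ge k True by auto
  then have "unit_prod s vs = unit_prod s (v # us)" using assms by (intro unit_prod_cong) auto
  then show ?thesis by simp
next
  case False
  show ?thesis
  proof (cases "3 dvd m \<longrightarrow> \<not> 3 dvd sum_list us - v")
    case True
    then show ?thesis using unit_prod_add_unit_aux False assms by blast
  next
    case bad: False
    \<comment> \<open>Here \<open>units_sum_two_shift\<close> fails modulo 3, but it applies to both steps of \<open>v = v1 + v2\<close>.\<close>
    have k: "k = 2" using k False by auto
    obtain v1 where v1: "coprime v1 m" "coprime (v - v1) m"
      using units_sum_two[of m v] m_pos False by auto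
    define v2 where "v2 = v - v1"
    obtain ws where ws: "units ws" "length ws \<le> k" "sum_list ws = sum_list us + v1"
      using ex_units by blast
    have n3: "\<not> 3 dvd x" if "coprime x m" for x
      using coprime_common_divisor[OF that, of 3] bad by auto
    \<comment> \<open>Modulo 3 all three are nonzero, so \<open>v1\<close> and \<open>v2\<close> are
      both congruent to \<open>- v\<close>, while \<open>sum_list us\<close> is congruent to
      \<open>v\<close>.\<close>
    then have "\<not> 3 dvd v" "\<not> 3 dvd v1" "\<not> 3 dvd v - v1" using assms(6) v1 by auto
    moreover have "3 dvd sum_list us - v" using bad by simp
    ultimately have g: "\<not> 3 dvd sum_list us - v1" "\<not> 3 dvd sum_list ws - v2"
      unfolding ws(3) v2_def by presburger+
    have "unit_prod s ws = unit_prod s us * h (\<lambda>i. v1 * s i)"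
      using unit_prod_add_unit_aux[OF False assms(1,2) ws(1) assms(4) ws(2) v1(1) ws(3)] g by blast
    moreover have "unit_prod s vs = unit_prod s ws * h (\<lambda>i. v2 * s i)"
      using g v1 ws assms by (intro unit_prod_add_unit_aux[OF False assms(1)]) (auto simp: v2_def)
    moreover have "unit_prod s [v1, v2] = unit_prod s [v]"
      using assms v1 N_ge k by (intro unit_prod_cong) (auto simp: v2_def)
    ultimately show ?thesis by simp
  qed
qed

text \<open>Raising the sum by 1 multiplies both sides by \<open>h s\<close>, so induction from 0 in
  both directions reaches every integer. All lists with a given sum are treated at once, as the
  lists chosen at successive sums are unrelated.\<close>

lemma unit_prod_eq_power:
  assumes "s \<in> S" "units us" "length us \<le> k"
  shows "unit_prod s us = h s powi (sum_list us)"
proof -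
  have "\<forall>us. units us \<and> length us \<le> k \<and> sum_list us = c \<longrightarrow> unit_prod s us = h s powi c" for c
  proof (induction c rule: int_induct[where k = 0])
    case base
    then show ?case using unit_prod_cong[of s _ "[]"] N_ge assms(1) by auto
  next
    case (step1 c)
    obtain vs where "units vs" "length vs \<le> k" "sum_list vs = c" using ex_units by blast
    then show ?case using unit_prod_add_unit[of s vs _ 1] step1 assms(1) h_nonzero[OF assms(1)]
      by (auto simp: power_int_add)
  next
    case (step2 c)
    obtain vs where "units vs" "length vs \<le> k" "sum_list vs = c" using ex_units by blast
    then have "unit_prod s us * h s = h s powi c"
      if "units us" "length us \<le> k" "sum_list us = c - 1" for us
      using unit_prod_add_unit[of s us vs 1] step2 assms(1) that by auto
    then show ?case using h_nonzero[OF assms(1)] by (auto simp: power_int_diff field_simps)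
  qed
  then show ?thesis using assms by blast
qed

text \<open>Writing each coefficient as a sum of at most \<open>k\<close> units costs at most
  \<open>k * (length a + 1)\<close> terms in all, which is within \<open>N\<close>.\<close>

lemma rel_few:
  assumes "finite B" "card B \<le> length a + 1" "\<And>b. b \<in> B \<Longrightarrow> w b \<in> S"
    and "null_vec a (\<lambda>i. \<Sum>b\<in>B. c b * w b i)"
  shows "(\<Prod>b\<in>B. h (w b) powi c b) = 1"
proof -
  obtain xs where xs: "set xs = B" "distinct xs" using finite_distinct_list[OF assms(1)] by blast
  obtain R where R: "\<And>c. units (R c) \<and> length (R c) \<le> k \<and> sum_list (R c) = c"
    using ex_units by metis
  define L where "L = map (\<lambda>b. (w b, R (c b))) xs"
  have "(\<Sum>(s, us)\<leftarrow>L. length us) = (\<Sum>b\<in>B. length (R (c b)))"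
    using xs by (simp add: L_def o_def sum_list_distinct_conv_sum_set)
  also have "\<dots> \<le> (\<Sum>b\<in>B. k)" using R by (intro sum_mono) blast
  also have "\<dots> \<le> k * (length a + 1)" using mult_le_mono2[OF assms(2), of k] by (simp add: mult.commute)
  finally have "(\<Sum>(s, us)\<leftarrow>L. length us) \<le> N" using N by simp
  moreover have "(\<Sum>(s, us)\<leftarrow>L. sum_list us * s i) = (\<Sum>b\<in>B. c b * w b i)" for i
    using xs R by (simp add: L_def o_def sum_list_distinct_conv_sum_set)
  ultimately have "(\<Prod>(s, us)\<leftarrow>L. unit_prod s us) = 1"
    using R assms(3,4) xs by (intro rel_units) (auto simp: L_def)
  also have "(\<Prod>(s, us)\<leftarrow>L. unit_prod s us) = (\<Prod>b\<in>B. unit_prod (w b) (R (c b)))"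
    unfolding xs(1)[symmetric] L_def
    using xs(2) by (simp add: o_def prod.distinct_set_conv_list)
  also have "\<dots> = (\<Prod>b\<in>B. h (w b) powi c b)"
    using unit_prod_eq_power R assms(3) by (intro prod.cong) auto
  finally show ?thesis .
qed

lemma h_power_m:
  assumes "s \<in> S" "m dvd c" shows "h s powi c = 1"
proof -
  have "null_vec a (\<lambda>i. \<Sum>b\<in>{()}. c * s i)"
    using assms(2) a_dvd by (auto simp: null_vec_def intro: dvd_trans)
  then show ?thesis using rel_few[of "{()}" "\<lambda>_. s" "\<lambda>_. c"] assms(1) by simp
qed

text \<open>Among any \<open>r + 1\<close> of the vectors, one is, on the \<open>p\<close>-primary part, a combination of the
  others, so that it can be eliminated from the relation.\<close>
lemma rel_primary:
  assumes "prime p" "m = p ^ e * m'" "finite B" "\<And>b. b \<in> B \<Longrightarrow> w b \<in> S"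
    and "null_vec a (\<lambda>i. \<Sum>b\<in>B. m' * n b * w b i)"
  shows "(\<Prod>b\<in>B. h (w b) powi (m' * n b)) = 1"
  using assms(3-)
proof (induction "card B" arbitrary: B n rule: less_induct)
  case less
  show ?case
  proof (cases "card B \<le> length a + 1")
    case True
    then show ?thesis using rel_few[of B w "\<lambda>b. m' * n b"] less.prems by simp
  next
    case False
    then obtain C where C: "C \<subseteq> B" "card C = length a + 1" "finite C"
      using obtain_subset_with_card_n[of "length a + 1" B] by (metis nat_le_linear)
    obtain c where c: "\<forall>j<length a. (\<Sum>b\<in>C. c b * w b j) = 0" "\<exists>b\<in>C. \<not> p dvd c b"
      using integer_dependence_primitive[OF C(3), of "length a" p w] C(2) prime_gt_1_int[OF assms(1)] by auto
    then obtain b0 where b0: "b0 \<in> C" "\<not> p dvd c b0" by blast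
    have "coprime (c b0) (p ^ e)"
      using b0(2) assms(1) prime_imp_coprime[of p "c b0"] by (simp add: coprime_commute)
    then obtain d where "[c b0 * d = 1] (mod (p ^ e))" using cong_solve_coprime_int by blast
    then have d: "p ^ e dvd 1 - d * c b0" by (simp add: cong_iff_dvd_diff dvd_diff_commute mult.commute)
    have relC: "(\<Prod>b\<in>C. h (w b) powi c b) = 1"
      using C less.prems(2) c(1) by (intro rel_few) (auto simp: null_vec_def)
    \<comment> \<open>\<open>d\<close> inverts \<open>c b0\<close> modulo \<open>p ^ e\<close>.
      Subtracting \<open>f\<close> times the dependence on \<open>C\<close> makes the coefficient at
      \<open>b0\<close> divisible by \<open>p ^ e\<close>, and after multiplication by
      \<open>m'\<close> divisible by \<open>m\<close>.\<close>
    define f where "f = n b0 * d"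
    define n' where "n' b = n b - (if b \<in> C then f * c b else 0)" for b
    have Bs: "w b \<in> S" if "b \<in> B" for b using less.prems(2) that .
    have "n' b0 = n b0 * (1 - d * c b0)" using b0(1) by (simp add: n'_def f_def algebra_simps)
    then have m0: "m dvd m' * n' b0" using d assms(2) by (simp add: mult.commute mult_dvd_mono dvd_mult2)
    have "(\<Sum>b\<in>B. m' * n' b * w b i) = (\<Sum>b\<in>B. m' * n b * w b i)" if "i < length a" for i
    proof -
      have "(\<Sum>b\<in>B. m' * n' b * w b i)
          = (\<Sum>b\<in>B. m' * n b * w b i - (if b \<in> C then m' * f * (c b * w b i) else 0))"
        by (rule sum.cong) (auto simp: n'_def algebra_simps)
      also have "\<dots> = (\<Sum>b\<in>B. m' * n b * w b i) - (\<Sum>b\<in>B. if b \<in> C then m' * f * (c b * w b i) else 0)"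
        by (rule sum_subtractf)
      also have "(\<Sum>b\<in>B. if b \<in> C then m' * f * (c b * w b i) else 0) = (\<Sum>b\<in>C. m' * f * (c b * w b i))"
        using C(1) less.prems(1) by (simp add: sum.inter_restrict[symmetric] Int_absorb1)
      also have "\<dots> = m' * f * (\<Sum>b\<in>C. c b * w b i)" by (simp only: sum_distrib_left)
      finally show ?thesis using c(1) that by simp
    qed
    then have "null_vec a (\<lambda>i. \<Sum>b\<in>B. m' * n' b * w b i)" using less.prems(3) by (simp add: null_vec_def)
    moreover have "(\<Sum>b\<in>B. m' * n' b * w b i) = m' * n' b0 * w b0 i + (\<Sum>b\<in>B - {b0}. m' * n' b * w b i)" for i
      using less.prems(1) b0(1) C(1) by (intro sum.remove) auto
    moreover have "int (a ! i) dvd m' * n' b0 * w b0 i" if "i < length a" for i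
      using m0 a_dvd[OF that] by (meson dvd_mult2 dvd_trans)
    ultimately have "null_vec a (\<lambda>i. \<Sum>b\<in>B - {b0}. m' * n' b * w b i)"
      unfolding null_vec_def by (metis (no_types, lifting) dvd_add_right_iff)
    moreover have "card (B - {b0}) < card B" using b0(1) C(1) less.prems(1) by (meson card_Diff1_less subsetD)
    ultimately have "(\<Prod>b\<in>B - {b0}. h (w b) powi (m' * n' b)) = 1"
      using less.hyps[of "B - {b0}" n'] less.prems by auto
    moreover have "h (w b0) powi (m' * n' b0) = 1" using h_power_m m0 Bs b0(1) C(1) by blast
    ultimately have 1: "(\<Prod>b\<in>B. h (w b) powi (m' * n' b)) = 1"
      using less.prems(1) b0(1) C(1) by (subst prod.remove[of B b0]) auto
    \<comment> \<open>Undoing the subtraction contributes a power of the product in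
      \<open>relC\<close>, which is 1.\<close>
    have "(\<Prod>b\<in>B. h (w b) powi (m' * n b))
        = (\<Prod>b\<in>B. h (w b) powi (m' * n' b) * (if b \<in> C then (h (w b) powi c b) powi (m' * f) else 1))"
    proof (rule prod.cong[OF refl])
      fix b assume "b \<in> B"
      have "m' * n b = m' * n' b + (if b \<in> C then c b * (m' * f) else 0)"
        by (simp add: n'_def algebra_simps)
      then show "h (w b) powi (m' * n b)
          = h (w b) powi (m' * n' b) * (if b \<in> C then (h (w b) powi c b) powi (m' * f) else 1)"
        using h_nonzero[OF Bs[OF \<open>b \<in> B\<close>]] by (simp add: power_int_add power_int_mult)
    qed
    also have "\<dots> = (\<Prod>b\<in>B. if b \<in> C then (h (w b) powi c b) powi (m' * f) else 1)"
      by (simp add: prod.distrib 1)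
    also have "\<dots> = (\<Prod>b\<in>C. (h (w b) powi c b) powi (m' * f))"
      using C(1) less.prems(1) by (simp add: prod.inter_restrict[symmetric] Int_absorb1)
    also have "\<dots> = (\<Prod>b\<in>C. h (w b) powi c b) powi (m' * f)"
      by (induction C rule: infinite_finite_induct) (auto simp: power_int_mult_distrib)
    finally show ?thesis using relC by simp
  qed
qed

text \<open>The product \<open>x\<close> satisfies \<open>x powi m = 1\<close>. It is 1 because no
  prime \<open>p\<close> divides its order: by \<open>rel_primary\<close> the order divides the part
  of \<open>m\<close> prime to \<open>p\<close>.\<close>

lemma all_relations:
  assumes "finite B" "\<And>b. b \<in> B \<Longrightarrow> w b \<in> S" "null_vec a (\<lambda>i. \<Sum>b\<in>B. n b * w b i)"
  shows "(\<Prod>b\<in>B. h (w b) powi n b) = 1"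
proof -
  define x where "x = (\<Prod>b\<in>B. h (w b) powi n b)"
  have pw: "x powi c = (\<Prod>b\<in>B. h (w b) powi (c * n b))" for c
    unfolding x_def using assms(1)
    by (induction B) (auto simp: power_int_mult_distrib power_int_mult mult.commute[of c])
  have x0: "x \<noteq> 0" using assms(1,2) h_nonzero by (auto simp: x_def)
  have xm: "x powi m = 1" unfolding pw using h_power_m assms(2) by (intro prod.neutral) auto
  \<comment> \<open>The multiplicative order of \<open>x\<close>.\<close>
  define q where "q = (LEAST j. j > 0 \<and> x ^ j = 1)"
  have "nat m > 0 \<and> x ^ nat m = 1" using m_pos xm by (simp add: power_int_def)
  then have q: "q > 0" "x ^ q = 1" using LeastI[of "\<lambda>j. j > 0 \<and> x ^ j = 1" "nat m"] unfolding q_def by blast+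
  have q_dvd: "int q dvd j" if "x powi j = 1" for j
  proof -
    have "x powi (j mod int q) = x powi (j - int q * (j div int q))" by (simp add: minus_mult_div_eq_mod)
    also have "\<dots> = 1" using that x0 q(2) by (simp add: power_int_diff power_int_mult)
    finally have "x ^ nat (j mod int q) = 1" using q(1) by (simp add: power_int_def split: if_splits)
    moreover have "nat (j mod int q) < q" using q(1) by (simp add: nat_less_iff)
    ultimately have "nat (j mod int q) = 0" using not_less_Least[of "nat (j mod int q)" "\<lambda>j. j > 0 \<and> x ^ j = 1", folded q_def]
      by simp
    then have "j mod int q = 0" using pos_mod_sign[of "int q" j] q(1) by linarith
    then show ?thesis by auto
  qed
  have "q = 1"
  proof (rule ccontr)
    assume "q \<noteq> 1"
    then obtain p where p: "prime p" "p dvd q" using prime_factor_nat by blast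
    define e where "e = multiplicity (int p) m"
    obtain m' where m': "m = int p ^ e * m'" "\<not> int p dvd m'"
      using multiplicity_decompose'[of m "int p"] m_pos p(1) not_prime_unit[of "int p"]
      unfolding e_def by (metis less_irrefl prime_nat_int_transfer)
    have "x powi m' = 1" unfolding pw
    proof (rule rel_primary[OF _ m'(1) assms(1,2)])
      have "null_vec a (\<lambda>i. m' * (\<Sum>b\<in>B. n b * w b i))" using assms(3) by (auto simp: null_vec_def)
      then show "null_vec a (\<lambda>i. \<Sum>b\<in>B. m' * n b * w b i)" by (simp add: sum_distrib_left mult.assoc)
    qed (use p in auto)
    then have "int q dvd m'" by (rule q_dvd)
    then show False using p(2) m'(2) by (meson dvd_trans int_dvd_int_iff)
  qed
  then show ?thesis using q(2) by (simp add: x_def)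
qed

end

subsection \<open>The grid and its characters\<close>

lemma grid_Nil: "grid [] = {[]}"
  by (auto simp: grid_def)

lemma grid_Cons: "grid (n # a) = (\<lambda>(x, xs). x # xs) ` ({0..<int n} \<times> grid a)"
proof (rule Set.set_eqI)
  fix xs
  show "xs \<in> grid (n # a) \<longleftrightarrow> xs \<in> (\<lambda>(x, xs). x # xs) ` ({0..<int n} \<times> grid a)"
    by (cases xs) (auto simp: grid_def All_less_Suc2)
qed

lemma finite_grid: "finite (grid a)"
  by (induction a) (auto simp: grid_Nil grid_Cons)

lemma card_grid: "card (grid a) = prod_list a"
proof (induction a)
  case (Cons n a)
  have "inj_on (\<lambda>(x, xs). x # xs) ({0..<int n} \<times> grid a)" by (auto simp: inj_on_def)
  then show ?case using Cons by (simp add: grid_Cons card_image card_cartesian_product)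
qed (simp add: grid_Nil)

lemma nth_dvd_card_grid: "i < length a \<Longrightarrow> a ! i dvd card (grid a)"
  unfolding card_grid by (metis nth_mem in_set_conv_decomp prod_list.append prod_list.Cons dvd_triv_left dvd_mult)

lemma length_gadd [simp]: "length (gadd a x y) = length a"
  by (simp add: gadd_def)

lemma nth_gadd [simp]: "i < length a \<Longrightarrow> gadd a x y ! i = (x ! i + y ! i) mod int (a ! i)"
  by (simp add: gadd_def)

lemma gadd_commute: "gadd a x y = gadd a y x"
  by (simp add: gadd_def add.commute)

lemma grid_eqI:
  assumes "x \<in> grid a" "y \<in> grid a" "null_vec a (\<lambda>i. x ! i - y ! i)"
  shows "x = y"
proof (rule nth_equalityI)
  fix i assume "i < length x"
  then have "i < length a" using assms(1) by (simp add: grid_def)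
  then have "0 \<le> x ! i" "x ! i < int (a ! i)" "0 \<le> y ! i" "y ! i < int (a ! i)" "int (a ! i) dvd x ! i - y ! i"
    using assms by (auto simp: grid_def null_vec_def)
  then show "x ! i = y ! i" by (metis mod_eq_dvd_iff mod_pos_pos_trivial)
qed (use assms in \<open>auto simp: grid_def\<close>)

text \<open>The symmetric pairing of the grid with its character group. Both arguments are integer
  vectors; a list \<open>x\<close> enters as \<open>(!) x\<close>.\<close>

definition chi :: "nat list \<Rightarrow> (nat \<Rightarrow> int) \<Rightarrow> (nat \<Rightarrow> int) \<Rightarrow> complex" where
  "chi a v w = cis (2 * pi * (\<Sum>i<length a. of_int (v i * w i) / real (a ! i)))"

definition fourier :: "nat list \<Rightarrow> (int list \<Rightarrow> complex) \<Rightarrow> (nat \<Rightarrow> int) \<Rightarrow> complex" where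
  "fourier a f v = (\<Sum>x\<in>grid a. f x * chi a v ((!) x))"

section \<open>Multiplicativity and orthogonality of the characters\<close>

lemma chi_commute: "chi a v w = chi a w v"
  by (simp add: chi_def mult.commute)

lemma chi_add: "chi a (\<lambda>i. u i + v i) w = chi a u w * chi a v w"
  by (simp add: chi_def cis_mult distrib_left distrib_right add_divide_distrib sum.distrib)

lemma chi_uminus: "chi a (\<lambda>i. - v i) w = cnj (chi a v w)"
  by (simp add: chi_def cis_cnj sum_negf)

lemma chi_nonzero [simp]: "chi a v w \<noteq> 0"
  by (simp add: chi_def)

lemma chi_zero [simp]: "chi a (\<lambda>i. 0) w = 1"
  by (simp add: chi_def)

lemma chi_mult_nat: "chi a (\<lambda>i. int n * v i) w = chi a v w ^ n"
proof (induction n)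
  case (Suc n)
  have "chi a (\<lambda>i. int (Suc n) * v i) w = chi a (\<lambda>i. v i + int n * v i) w"
    by (simp add: algebra_simps)
  then show ?case using Suc by (simp add: chi_add)
qed simp

lemma chi_sum: "finite K \<Longrightarrow> chi a (\<lambda>i. \<Sum>k\<in>K. c k i) w = (\<Prod>k\<in>K. chi a (c k) w)"
  by (induction K rule: finite_induct) (simp_all add: chi_add)

lemma chi_sum_list: "chi a (\<lambda>i. \<Sum>v\<leftarrow>vs. v i) w = (\<Prod>v\<leftarrow>vs. chi a v w)"
  by (induction vs) (simp_all add: chi_add)

text \<open>Distributivity with lists as index tuples, the form in which \<open>autocorr\<close>
  takes its arguments.\<close>

lemma prod_list_sum_distrib:
  fixes F :: "'v \<Rightarrow> 'z \<Rightarrow> complex"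
  assumes "finite G"
  shows "(\<Prod>v\<leftarrow>vs. \<Sum>z\<in>G. F v z)
    = (\<Sum>zs\<in>{zs. set zs \<subseteq> G \<and> length zs = length vs}. \<Prod>(v, z)\<leftarrow>zip vs zs. F v z)"
proof (induction vs)
  case (Cons v vs)
  let ?L = "{zs. set zs \<subseteq> G \<and> length zs = length vs}"
  have "inj_on (\<lambda>(zs, z). z # zs) (?L \<times> G)" by (auto simp: inj_on_def)
  then have "(\<Sum>zs\<in>{zs. set zs \<subseteq> G \<and> length zs = length (v # vs)}. \<Prod>(v, z)\<leftarrow>zip (v # vs) zs. F v z)
      = (\<Sum>(zs, z)\<in>?L \<times> G. F v z * (\<Prod>(v, z)\<leftarrow>zip vs zs. F v z))"
    by (simp add: lists_length_Suc_eq sum.reindex o_def case_prod_unfold)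
  also have "\<dots> = (\<Prod>v\<leftarrow>v # vs. \<Sum>z\<in>G. F v z)"
    by (simp add: Cons.IH sum.cartesian_product[symmetric] sum_product sum.swap[of _ ?L])
  finally show ?case by simp
next
  case Nil
  have "{zs. set zs \<subseteq> G \<and> length zs = length []} = {[]}" by auto
  then show ?case by simp
qed

context
  fixes a :: "nat list"
  assumes a_pos: "\<forall>k<length a. a ! k > 0"
begin

lemma card_grid_pos: "card (grid a) > 0"
  unfolding card_grid using a_pos by (induction a) (auto simp: All_less_Suc2)

lemma gadd_in_grid: "gadd a x y \<in> grid a"
  using a_pos by (auto simp: grid_def)

lemma chi_null:
  assumes "null_vec a v" shows "chi a v w = 1"
proof -
  have "\<exists>n::int. of_int (v i * w i) / real (a ! i) = of_int n" if i: "i < length a" for i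
  proof -
    obtain n where "v i = int (a ! i) * n" using assms i by (auto simp: null_vec_def)
    then have "of_int (v i * w i) / real (a ! i) = of_int (n * w i)"
      using a_pos[rule_format, OF i] by simp
    then show ?thesis by blast
  qed
  then obtain n :: "nat \<Rightarrow> int" where "\<And>i. i < length a \<Longrightarrow> of_int (v i * w i) / real (a ! i) = of_int (n i)"
    by metis
  then have "(\<Sum>i<length a. of_int (v i * w i) / real (a ! i)) = of_int (\<Sum>i<length a. n i)"
    unfolding of_int_sum by (intro sum.cong) auto
  then show ?thesis unfolding chi_def by (simp only:) (rule cis_multiple_2pi, rule Ints_of_int)
qed

lemma chi_cong:
  assumes "null_vec a (\<lambda>i. u i - v i)" shows "chi a u w = chi a v w"
  using chi_add[of a "\<lambda>i. u i - v i" v w] chi_null[OF assms] by simp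

lemma chi_power_card: "chi a v w ^ card (grid a) = 1"
  unfolding chi_mult_nat[symmetric] using nth_dvd_card_grid by (intro chi_null) (auto simp: null_vec_def)

lemma chi_gadd: "chi a v ((!) (gadd a x y)) = chi a v ((!) x) * chi a v ((!) y)"
proof -
  have "chi a ((!) (gadd a x y)) v = chi a (\<lambda>i. x ! i + y ! i) v"
    by (intro chi_cong) (auto simp: null_vec_def mod_eq_dvd_iff[symmetric])
  then show ?thesis by (simp add: chi_add chi_commute[of a v])
qed

lemma sum_grid_shift: "(\<Sum>x\<in>grid a. F (gadd a y x)) = (\<Sum>x\<in>grid a. F x)"
proof -
  have inj: "inj_on (gadd a y) (grid a)"
  proof (rule inj_onI)
    fix x x' assume x: "x \<in> grid a" "x' \<in> grid a" "gadd a y x = gadd a y x'"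
    have "int (a ! i) dvd x ! i - x' ! i" if "i < length a" for i
    proof -
      have "(y ! i + x ! i) mod int (a ! i) = (y ! i + x' ! i) mod int (a ! i)"
        using arg_cong[OF x(3), of "\<lambda>z. z ! i"] that by simp
      then show ?thesis by (simp add: mod_eq_dvd_iff)
    qed
    then show "x = x'" using grid_eqI x by (simp add: null_vec_def)
  qed
  moreover have "gadd a y ` grid a \<subseteq> grid a" using gadd_in_grid by auto
  ultimately have "gadd a y ` grid a = grid a" using endo_inj_surj finite_grid by blast
  then show ?thesis using sum.reindex[OF inj, of F] by simp
qed

lemma sum_chi:
  "(\<Sum>y\<in>grid a. chi a v ((!) y)) = (if null_vec a v then of_nat (card (grid a)) else 0)"
proof (cases "null_vec a v")
  case True
  then show ?thesis by (simp add: chi_null)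
next
  case False
  then obtain j where j: "j < length a" "\<not> int (a ! j) dvd v j" by (auto simp: null_vec_def)
  \<comment> \<open>The \<open>j\<close>-th unit vector; the character is nontrivial there, and
    translation by \<open>y0\<close> multiplies the sum by that value.\<close>
  define y0 where "y0 = map (\<lambda>i. if i = j then 1 else 0 :: int) [0..<length a]"
  have "(\<Sum>i<length a. of_int (v i * y0 ! i) / real (a ! i)) = (\<Sum>i<length a. if i = j then of_int (v i) / real (a ! i) else 0)"
    by (rule sum.cong) (auto simp: y0_def)
  then have c: "chi a v ((!) y0) = cis (2 * pi * (of_int (v j) / real (a ! j)))"
    using j(1) by (simp add: chi_def)
  have "chi a v ((!) y0) \<noteq> 1"
  proof
    assume "chi a v ((!) y0) = 1"
    then have "cos (2 * pi * (of_int (v j) / real (a ! j))) = 1" unfolding c by (simp add: complex_eq_iff)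
    then obtain n :: int where "2 * pi * (of_int (v j) / real (a ! j)) = of_int n * 2 * pi"
      using cos_one_2pi_int by auto
    then have "of_int (v j) = real (a ! j) * of_int n" using a_pos j(1) by (auto simp: field_simps)
    then have "v j = int (a ! j) * n" by (metis of_int_eq_iff of_int_mult of_int_of_nat_eq)
    then show False using j(2) by simp
  qed
  moreover have "(\<Sum>y\<in>grid a. chi a v ((!) y)) = chi a v ((!) y0) * (\<Sum>y\<in>grid a. chi a v ((!) y))"
    using sum_grid_shift[of "\<lambda>y. chi a v ((!) y)" y0] by (simp add: chi_gadd sum_distrib_left)
  ultimately show ?thesis using False by auto
qed

text \<open>If no \<open>y\<close> worked, then each product over \<open>K\<close> of the geometric sums of the \<open>m\<close>-th roots of
  unity \<open>chi (w k) y * h k\<close> would vanish, whereas the total of these products over \<open>y\<close> counts the relations.\<close>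
lemma ex_dual_point:
  fixes w :: "'k \<Rightarrow> nat \<Rightarrow> int" and h :: "'k \<Rightarrow> complex"
  assumes fin: "finite K"
    and rel: "\<And>n. null_vec a (\<lambda>i. \<Sum>k\<in>K. int (n k) * w k i) \<Longrightarrow> (\<Prod>k\<in>K. h k ^ n k) = 1"
  shows "\<exists>y\<in>grid a. \<forall>k\<in>K. chi a (w k) ((!) y) * h k = 1"
proof (rule ccontr)
  assume neg: "\<not> ?thesis"
  define m where "m = card (grid a)"
  \<comment> \<open>Taking \<open>w k\<close> exactly \<open>m\<close> times is a relation, so
    \<open>h k\<close> is an \<open>m\<close>-th root of unity, as the geometric sums
    require.\<close>
  have hm: "h k ^ m = 1" if "k \<in> K" for k
  proof -
    have "(\<Sum>l\<in>K. int (if l = k then m else 0) * w l i) = (\<Sum>l\<in>K. if l = k then int m * w k i else 0)" for i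
      by (rule sum.cong) auto
    then have "null_vec a (\<lambda>i. \<Sum>l\<in>K. int (if l = k then m else 0) * w l i)"
      using nth_dvd_card_grid[of _ a] fin that by (auto simp: null_vec_def m_def)
    from rel[OF this] have "(\<Prod>l\<in>K. if l = k then h k ^ m else 1) = 1"
      by (auto cong: prod.cong if_cong simp: if_distrib)
    then show ?thesis using fin that by simp
  qed
  let ?z = "\<lambda>y k. chi a (w k) ((!) y) * h k"
  let ?R = "K \<rightarrow>\<^sub>E {..<m}"
  have "(\<Prod>k\<in>K. \<Sum>n<m. ?z y k ^ n) = 0" if "y \<in> grid a" for y
  proof -
    obtain k where k: "k \<in> K" "?z y k \<noteq> 1" using neg \<open>y \<in> grid a\<close> by blast
    have "?z y k ^ m = 1" using hm[OF k(1)] chi_power_card by (simp add: power_mult_distrib m_def)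
    then have "(\<Sum>n<m. ?z y k ^ n) = 0" using k(2) by (simp add: geometric_sum)
    then show ?thesis using k(1) fin by (intro prod_zero) auto
  qed
  then have "0 = (\<Sum>y\<in>grid a. \<Prod>k\<in>K. \<Sum>n<m. ?z y k ^ n)" by simp
  also have "\<dots> = (\<Sum>y\<in>grid a. \<Sum>n\<in>?R. \<Prod>k\<in>K. ?z y k ^ n k)"
    using fin by (simp add: prod_sum_PiE)
  also have "\<dots> = (\<Sum>n\<in>?R. \<Sum>y\<in>grid a. \<Prod>k\<in>K. ?z y k ^ n k)" by (rule sum.swap)
  \<comment> \<open>Orthogonality keeps only the exponents \<open>n\<close> that form a relation,
    and there \<open>rel\<close> makes the factor from \<open>h\<close> equal to 1.\<close>
  also have "\<dots> = (\<Sum>n\<in>?R. if null_vec a (\<lambda>i. \<Sum>k\<in>K. int (n k) * w k i) then of_nat m else 0)"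
  proof (rule sum.cong[OF refl])
    fix n assume "n \<in> ?R"
    have "(\<Prod>k\<in>K. ?z y k ^ n k) = chi a (\<lambda>i. \<Sum>k\<in>K. int (n k) * w k i) ((!) y) * (\<Prod>k\<in>K. h k ^ n k)" for y
      using fin by (simp add: power_mult_distrib prod.distrib chi_sum chi_mult_nat)
    then have "(\<Sum>y\<in>grid a. \<Prod>k\<in>K. ?z y k ^ n k)
        = (\<Sum>y\<in>grid a. chi a (\<lambda>i. \<Sum>k\<in>K. int (n k) * w k i) ((!) y)) * (\<Prod>k\<in>K. h k ^ n k)"
      by (simp add: sum_distrib_right)
    then show "(\<Sum>y\<in>grid a. \<Prod>k\<in>K. ?z y k ^ n k)
        = (if null_vec a (\<lambda>i. \<Sum>k\<in>K. int (n k) * w k i) then of_nat m else 0)"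
      using rel[of n] by (simp add: sum_chi m_def)
  qed
  also have "\<dots> = of_nat (\<Sum>n\<in>?R. if null_vec a (\<lambda>i. \<Sum>k\<in>K. int (n k) * w k i) then m else 0)"
    unfolding of_nat_sum by (intro sum.cong) auto
  finally have "(\<Sum>n\<in>?R. if null_vec a (\<lambda>i. \<Sum>k\<in>K. int (n k) * w k i) then m else 0) = 0"
    unfolding of_nat_eq_0_iff eq_commute[of 0] .
  moreover have "finite ?R" using fin by (intro finite_PiE) auto
  ultimately have no_rel: "n \<in> ?R \<Longrightarrow> null_vec a (\<lambda>i. \<Sum>k\<in>K. int (n k) * w k i) \<Longrightarrow> m = 0" for n
    by (metis (mono_tags, lifting) sum_eq_0_iff)
  have m0: "m > 0" using card_grid_pos by (simp add: m_def)
  \<comment> \<open>The zero exponents form a relation, so the count cannot be 0.\<close>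
  then have "restrict (\<lambda>_. 0) K \<in> ?R" by auto
  moreover have "null_vec a (\<lambda>i. \<Sum>k\<in>K. int (restrict (\<lambda>_. 0) K k) * w k i)" by (simp add: null_vec_def)
  ultimately show False using m0 no_rel by blast
qed

subsection \<open>Fourier coefficients and autocorrelations\<close>

lemma fourier_cong: "null_vec a (\<lambda>i. u i - v i) \<Longrightarrow> fourier a f u = fourier a f v"
  unfolding fourier_def using chi_cong by metis

text \<open>Fourier inversion: summing the coefficients against the conjugate character at
  \<open>x0\<close> isolates \<open>f x0\<close> times the size of the grid.\<close>

lemma fourier_zero_imp:
  assumes zero: "\<And>k. k \<in> grid a \<Longrightarrow> fourier a f ((!) k) = 0" and x0: "x0 \<in> grid a"
  shows "f x0 = 0"
proof -
  have "0 = (\<Sum>k\<in>grid a. fourier a f ((!) k) * chi a (\<lambda>i. - x0 ! i) ((!) k))" using zero by simp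
  also have "\<dots> = (\<Sum>k\<in>grid a. \<Sum>x\<in>grid a. f x * chi a (\<lambda>i. x ! i - x0 ! i) ((!) k))"
    using chi_add[of a _ "\<lambda>i. - x0 ! i"]
    by (simp add: fourier_def sum_distrib_right mult.assoc chi_commute[of a "(!) _" "(!) _"])
  also have "\<dots> = (\<Sum>x\<in>grid a. f x * (\<Sum>k\<in>grid a. chi a (\<lambda>i. x ! i - x0 ! i) ((!) k)))"
    unfolding sum_distrib_left by (rule sum.swap)
  also have "\<dots> = (\<Sum>x\<in>grid a. if x = x0 then f x0 * of_nat (card (grid a)) else 0)"
  proof (rule sum.cong[OF refl])
    fix x assume "x \<in> grid a"
    then have "null_vec a (\<lambda>i. x ! i - x0 ! i) \<longleftrightarrow> x = x0" using grid_eqI x0 by (auto simp: null_vec_def)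
    then show "f x * (\<Sum>k\<in>grid a. chi a (\<lambda>i. x ! i - x0 ! i) ((!) k))
        = (if x = x0 then f x0 * of_nat (card (grid a)) else 0)" by (simp add: sum_chi)
  qed
  also have "\<dots> = f x0 * of_nat (card (grid a))" using x0 finite_grid by simp
  finally show ?thesis using card_grid_pos by simp
qed

text \<open>With \<open>y\<close> the variable of the first factor, the others are expanded in the
  differences from \<open>y\<close>. The character values at \<open>y\<close> multiply to 1 by
  \<open>null\<close>, and the sum over \<open>y\<close> becomes an autocorrelation.\<close>

lemma fourier_prod_list:
  fixes f :: "int list \<Rightarrow> rat"
  assumes null: "null_vec a (\<lambda>i. \<Sum>v\<leftarrow>v0 # vs. v i)"
  shows "(\<Prod>v\<leftarrow>v0 # vs. fourier a (of_rat \<circ> f) v) =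
    (\<Sum>zs\<in>{zs. set zs \<subseteq> grid a \<and> length zs = length vs}.
       (\<Prod>(v, z)\<leftarrow>zip vs zs. chi a v ((!) z)) * of_rat (autocorr a f zs))"
proof -
  let ?f = "of_rat \<circ> f :: int list \<Rightarrow> complex" and ?L = "{zs. set zs \<subseteq> grid a \<and> length zs = length vs}"
  let ?c = "\<lambda>zs. \<Prod>(v, z)\<leftarrow>zip vs zs. chi a v ((!) z)"
  have shift: "fourier a ?f v = chi a v ((!) y) * (\<Sum>z\<in>grid a. ?f (gadd a y z) * chi a v ((!) z))" for v y
    unfolding fourier_def sum_distrib_left
    by (subst sum_grid_shift[of _ y, symmetric]) (simp add: chi_gadd mult_ac)
  have prod: "(\<Prod>v\<leftarrow>vs. fourier a ?f v)
      = (\<Prod>v\<leftarrow>vs. chi a v ((!) y)) * (\<Sum>zs\<in>?L. ?c zs * (\<Prod>z\<leftarrow>zs. ?f (gadd a y z)))" for y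
  proof -
    have "(\<Prod>v\<leftarrow>vs. fourier a ?f v)
        = (\<Prod>v\<leftarrow>vs. chi a v ((!) y)) * (\<Prod>v\<leftarrow>vs. \<Sum>z\<in>grid a. ?f (gadd a y z) * chi a v ((!) z))"
      unfolding shift[of _ y] by (induction vs) auto
    also have "(\<Prod>v\<leftarrow>vs. \<Sum>z\<in>grid a. ?f (gadd a y z) * chi a v ((!) z))
        = (\<Sum>zs\<in>?L. \<Prod>(v, z)\<leftarrow>zip vs zs. ?f (gadd a y z) * chi a v ((!) z))"
      by (rule prod_list_sum_distrib[OF finite_grid])
    also have "\<dots> = (\<Sum>zs\<in>?L. ?c zs * (\<Prod>z\<leftarrow>zs. ?f (gadd a y z)))"
    proof (rule sum.cong[OF refl])
      fix zs assume "zs \<in> ?L"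
      then have "length vs = length zs" by simp
      then show "(\<Prod>(v, z)\<leftarrow>zip vs zs. ?f (gadd a y z) * chi a v ((!) z))
          = ?c zs * (\<Prod>z\<leftarrow>zs. ?f (gadd a y z))"
        by (induction vs zs rule: list_induct2) auto
    qed
    finally show ?thesis .
  qed
  have one: "chi a v0 ((!) y) * (\<Prod>v\<leftarrow>vs. chi a v ((!) y)) = 1" for y
    using chi_null[OF null, of "(!) y"] by (simp only: chi_sum_list) simp
  have prod_of_rat: "(\<Prod>z\<leftarrow>zs. ?f (gadd a y z)) = of_rat (\<Prod>z\<leftarrow>zs. f (gadd a y z))" for y zs
    by (induction zs) (auto simp: of_rat_mult)
  have "(\<Prod>v\<leftarrow>v0 # vs. fourier a ?f v) = (\<Sum>y\<in>grid a. ?f y * chi a v0 ((!) y) * (\<Prod>v\<leftarrow>vs. fourier a ?f v))"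
    by (simp add: fourier_def sum_distrib_right)
  also have "\<dots> = (\<Sum>y\<in>grid a. \<Sum>zs\<in>?L. ?c zs * (?f y * (\<Prod>z\<leftarrow>zs. ?f (gadd a y z))))"
  proof (rule sum.cong[OF refl])
    fix y
    have "?f y * chi a v0 ((!) y) * (\<Prod>v\<leftarrow>vs. fourier a ?f v)
       = ?f y * (chi a v0 ((!) y) * (\<Prod>v\<leftarrow>vs. chi a v ((!) y))) * (\<Sum>zs\<in>?L. ?c zs * (\<Prod>z\<leftarrow>zs. ?f (gadd a y z)))"
      unfolding prod[of y] by (simp only: mult.assoc)
    then show "?f y * chi a v0 ((!) y) * (\<Prod>v\<leftarrow>vs. fourier a ?f v)
        = (\<Sum>zs\<in>?L. ?c zs * (?f y * (\<Prod>z\<leftarrow>zs. ?f (gadd a y z))))"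
      unfolding one by (simp add: sum_distrib_left mult_ac)
  qed
  also have "\<dots> = (\<Sum>zs\<in>?L. ?c zs * (\<Sum>y\<in>grid a. ?f y * (\<Prod>z\<leftarrow>zs. ?f (gadd a y z))))"
    unfolding sum_distrib_left by (rule sum.swap)
  also have "\<dots> = (\<Sum>zs\<in>?L. ?c zs * of_rat (autocorr a f zs))"
    unfolding prod_of_rat by (simp add: autocorr_def of_rat_sum of_rat_mult)
  finally show ?thesis .
qed

lemma fourier_prod_list_eq:
  assumes "same_autocorr_upto a N f g" "null_vec a (\<lambda>i. \<Sum>v\<leftarrow>vs. v i)" "length vs \<le> N"
  shows "(\<Prod>v\<leftarrow>vs. fourier a (of_rat \<circ> g) v) = (\<Prod>v\<leftarrow>vs. fourier a (of_rat \<circ> f) v)"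
proof (cases vs)
  case (Cons v0 ws)
  \<comment> \<open>Order \<open>length vs\<close> means \<open>length ws\<close> arguments, one
    less; the empty list \<open>vs\<close> is trivial.\<close>
  have "autocorr a g zs = autocorr a f zs" if "set zs \<subseteq> grid a" "length zs = length ws" for zs
    using assms(1,3) that Cons unfolding same_autocorr_upto_def
    by (auto dest!: spec[of _ "length vs"])
  then show ?thesis
    using assms(2) unfolding Cons by (auto simp only: fourier_prod_list intro!: sum.cong)
qed simp

lemma fourier_uminus:
  fixes f :: "int list \<Rightarrow> rat"
  shows "fourier a (of_rat \<circ> f) (\<lambda>i. - v i) = cnj (fourier a (of_rat \<circ> f) v)"
proof -
  have "cnj (of_rat q) = of_rat q" for q by (cases q) (simp add: of_rat_rat)
  then show ?thesis by (simp add: fourier_def chi_uminus)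
qed

text \<open>For real-valued functions the relation of \<open>v\<close> with its negative yields the
  squared absolute value of the coefficient.\<close>

lemma fourier_eq_0_iff:
  assumes "same_autocorr_upto a N f g" "N \<ge> 2"
  shows "fourier a (of_rat \<circ> g) v = 0 \<longleftrightarrow> fourier a (of_rat \<circ> f) v = 0"
  using fourier_prod_list_eq[OF assms(1), of "[v, \<lambda>i. - v i]"] assms(2)
  by (auto simp: fourier_uminus null_vec_def)
end

subsection \<open>The support is closed under multiplication by units\<close>

context
  fixes a :: "nat list"
  assumes a_pos: "\<forall>k<length a. a ! k > 0"
begin

text \<open>The coefficient is a rational combination of roots of unity, and multiplying
  \<open>v\<close> by a unit conjugates them all.\<close>

lemma fourier_zero_unit_mult:
  fixes f :: "int list \<Rightarrow> rat"
  assumes zero: "fourier a (of_rat \<circ> f) v = 0" and "coprime u (int (card (grid a)))"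
  shows "fourier a (of_rat \<circ> f) (\<lambda>i. u * v i) = 0"
proof -
  let ?m = "card (grid a)"
  have m: "?m > 0" using card_grid_pos[OF a_pos] .
  \<comment> \<open>\<open>root_sum_conjugate\<close> takes natural exponents, so \<open>u\<close>
    is replaced by its residue.\<close>
  define t where "t = nat (u mod int ?m)"
  have t: "int t = u mod int ?m" using m by (simp add: t_def)
  have "coprime t ?m" using assms(2) t m by (metis coprime_int_iff coprime_mod_left_iff of_nat_0_eq_iff less_irrefl)
  have null: "null_vec a (\<lambda>i. u * v i - int t * v i)"
  proof (rule null_vecI)
    fix i assume "i < length a"
    then have "int (a ! i) dvd int ?m" using nth_dvd_card_grid by simp
    also have "int ?m dvd u - int t" unfolding t by (metis minus_mod_eq_mult_div dvd_triv_left)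
    finally show "int (a ! i) dvd u * v i - int t * v i" by (simp add: left_diff_distrib[symmetric])
  qed
  have "(\<Sum>x\<in>grid a. of_rat (f x) * chi a v ((!) x) ^ t) = 0"
    using zero chi_power_card[OF a_pos] \<open>coprime t ?m\<close>
    by (intro root_sum_conjugate[OF m finite_grid]) (auto simp: fourier_def)
  then have "fourier a (of_rat \<circ> f) (\<lambda>i. int t * v i) = 0"
    by (simp add: fourier_def chi_mult_nat)
  then show ?thesis using fourier_cong[OF a_pos null] by simp
qed

lemma fourier_zero_unit_mult_iff:
  fixes f :: "int list \<Rightarrow> rat"
  assumes "coprime u (int (card (grid a)))"
  shows "fourier a (of_rat \<circ> f) (\<lambda>i. u * v i) = 0 \<longleftrightarrow> fourier a (of_rat \<circ> f) v = 0"
proof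
  assume zero: "fourier a (of_rat \<circ> f) (\<lambda>i. u * v i) = 0"
  obtain d where d: "[u * d = 1] (mod int (card (grid a)))" using cong_solve_coprime_int[OF assms] by blast
  then have "coprime d (int (card (grid a)))" by (metis cong_imp_coprime cong_sym coprime_1_left coprime_mult_left_iff)
  from fourier_zero_unit_mult[OF zero this]
  have "fourier a (of_rat \<circ> f) (\<lambda>i. d * (u * v i)) = 0" .
  moreover have "null_vec a (\<lambda>i. d * (u * v i) - v i)"
  proof (rule null_vecI)
    fix i assume "i < length a"
    then have "int (a ! i) dvd int (card (grid a))" using nth_dvd_card_grid by simp
    also have "int (card (grid a)) dvd d * u - 1" using d by (simp add: cong_iff_dvd_diff mult.commute)
    also have "\<dots> dvd (d * u - 1) * v i" by simp
    finally show "int (a ! i) dvd d * (u * v i) - v i" by (simp add: algebra_simps)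
  qed
  ultimately show "fourier a (of_rat \<circ> f) v = 0" using fourier_cong[OF a_pos] by metis
qed (use fourier_zero_unit_mult assms in blast)

text \<open>The quotient \<open>h\<close> respects all relations on the support, so
  \<open>ex_dual_point\<close> realises it by a point \<open>y\<close>. Translating \<open>f\<close>
  by \<open>y\<close> then gives all coefficients of \<open>g\<close>.\<close>

lemma determined_up_to_translation:
  fixes f g :: "int list \<Rightarrow> rat"
  assumes same: "same_autocorr_upto a N f g" and N: "k * (length a + 1) \<le> N" and r: "length a \<ge> 1"
    and k: "odd (card (grid a)) \<and> k = 2 \<or> even (card (grid a)) \<and> k = 3"
  shows "\<exists>y\<in>grid a. \<forall>x\<in>grid a. g x = f (gadd a x y)"
proof -
  let ?F = "fourier a (of_rat \<circ> f)" and ?G = "fourier a (of_rat \<circ> g)"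
  define h where "h v = ?G v / ?F v" for v
  define S where "S = {v. ?F v \<noteq> 0}"
  have "2 \<le> k * (length a + 1)" using k r by auto
  then have N2: "2 \<le> N" using N by simp
  interpret short_relations a "int (card (grid a))" S h k N
  proof
    show "int (card (grid a)) > 0" using card_grid_pos[OF a_pos] by simp
    show "int (a ! i) dvd int (card (grid a))" if "i < length a" for i
      using nth_dvd_card_grid[OF that] by simp
    show "(\<lambda>i. u * s i) \<in> S" if "s \<in> S" "coprime u (int (card (grid a)))" for s u
      using that fourier_zero_unit_mult_iff by (simp add: S_def)
    show "prod_list (map h ss) = 1"
      if "length ss \<le> N" "set ss \<subseteq> S" "null_vec a (\<lambda>i. \<Sum>s\<leftarrow>ss. s i)" for ss
    proof -
      have "prod_list (map h ss) = (\<Prod>v\<leftarrow>ss. ?G v) / (\<Prod>v\<leftarrow>ss. ?F v)"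
        unfolding h_def by (induction ss) auto
      moreover have "(\<Prod>v\<leftarrow>ss. ?G v) = (\<Prod>v\<leftarrow>ss. ?F v)"
        using fourier_prod_list_eq[OF a_pos same] that by blast
      moreover have "(\<Prod>v\<leftarrow>ss. ?F v) \<noteq> 0"
        using that(2) by (auto simp: S_def prod_list_zero_iff)
      ultimately show ?thesis by simp
    qed
  qed (use N k r in auto)
  \<comment> \<open>Reduced representatives of the support, a finite set as
    \<open>ex_dual_point\<close> requires.\<close>
  define K where "K = {x \<in> grid a. (!) x \<in> S}"
  have finK: "finite K" using finite_grid by (simp add: K_def)
  have "(\<Prod>l\<in>K. h ((!) l) ^ n l) = 1" if "null_vec a (\<lambda>i. \<Sum>l\<in>K. int (n l) * (!) l i)" for n
    using all_relations[OF finK, of "(!)" "\<lambda>l. int (n l)"] that by (simp add: K_def)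
  then obtain y where y: "y \<in> grid a" "\<And>l. l \<in> K \<Longrightarrow> chi a ((!) l) ((!) y) * h ((!) l) = 1"
    using ex_dual_point[OF a_pos finK, of "(!)" "\<lambda>l. h ((!) l)"] by blast
  define D :: "int list \<Rightarrow> complex" where "D x = of_rat (g x) - of_rat (f (gadd a x y))" for x
  have "D x = 0" if "x \<in> grid a" for x
  proof (rule fourier_zero_imp[OF a_pos _ that])
    fix l assume l: "l \<in> grid a"
    let ?c = "chi a ((!) l)"
    \<comment> \<open>Translation by \<open>y\<close> divides the coefficient of \<open>f\<close> by
      \<open>?c ((!) y)\<close>, and by the choice of \<open>y\<close> this quotient is the
      coefficient of \<open>g\<close>; off the support both vanish.\<close>
    have "(\<Sum>x\<in>grid a. of_rat (f (gadd a x y)) * ?c ((!) x)) * ?c ((!) y)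
        = (\<Sum>x\<in>grid a. of_rat (f (gadd a y x)) * ?c ((!) (gadd a y x)))"
      by (simp add: sum_distrib_right chi_gadd[OF a_pos] gadd_commute[of a y] mult.assoc)
    also have "\<dots> = ?F ((!) l)"
      using sum_grid_shift[OF a_pos, of "\<lambda>x. of_rat (f x) * ?c ((!) x)" y] by (simp add: fourier_def)
    also have "\<dots> = ?G ((!) l) * ?c ((!) y)"
    proof (cases "(!) l \<in> S")
      case True
      then show ?thesis using y(2)[of l] l by (auto simp: h_def S_def K_def field_simps)
    next
      case False
      then show ?thesis using fourier_eq_0_iff[OF a_pos same N2, of "(!) l"] by (simp add: S_def)
    qed
    finally have "(\<Sum>x\<in>grid a. of_rat (f (gadd a x y)) * ?c ((!) x)) = ?G ((!) l)" by simp
    then show "fourier a D ((!) l) = 0"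
      by (simp add: fourier_def D_def left_diff_distrib sum_subtractf)
  qed
  then show ?thesis using y(1) by (auto simp: D_def)
qed

end

theorem mainTheorem1:
  fixes a :: "nat list" and f :: "int list \<Rightarrow> rat"
  assumes "length a \<ge> 1"
    and "\<forall>k<length a. a!k > 0"
  shows "(odd (card (grid a)) \<longrightarrow>
           (\<forall>g :: int list \<Rightarrow> rat. same_autocorr_upto a (2 * length a + 2) f g \<longrightarrow>
              (\<exists>y\<in>grid a. \<forall>x\<in>grid a. g x = f (gadd a x y))))
       \<and> (even (card (grid a)) \<longrightarrow>
           (\<forall>g :: int list \<Rightarrow> rat. same_autocorr_upto a (3 * length a + 3) f g \<longrightarrow>
              (\<exists>y\<in>grid a. \<forall>x\<in>grid a. g x = f (gadd a x y))))"
proof (intro conjI impI allI)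
  fix g :: "int list \<Rightarrow> rat"
  show "\<exists>y\<in>grid a. \<forall>x\<in>grid a. g x = f (gadd a x y)"
    if "odd (card (grid a))" "same_autocorr_upto a (2 * length a + 2) f g"
    using determined_up_to_translation[OF assms(2) that(2), of 2] that(1) assms(1) by simp
  show "\<exists>y\<in>grid a. \<forall>x\<in>grid a. g x = f (gadd a x y)"
    if "even (card (grid a))" "same_autocorr_upto a (3 * length a + 3) f g"
    using determined_up_to_translation[OF assms(2) that(2), of 3] that(1) assms(1) by simp
qed

end
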